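(* For a topological space $X$ the following assertions are equivalent: (i) $X$ is metrizable. (ii) $X$ is a $\mathfrak{P}$-space and has countable fan tightness. (iii) $X$ is an $\aleph$-space and is a Fréchet–Urysohn $(\alpha_4)$-space. (iv) $X$ is a strict $\aleph$-space and is a Fréchet–Urysohn $(\alpha_4)$-space. (v) $X$ is a strict $\sigma$-space and is an $M$-space.
   Context: All topological spaces are Hausdorff. Let $\mathcal N$ be a family of subsets of a space $X$. $\mathcal N$ is a $k$-network in $X$ if whenever $K\subset U$ with $K$ compact and $U$ open, then $K\subset\bigcup\mathcal F\subset U$ for some finite $\mathcal F\subset\mathcal N$. $\mathcal N$ is, at a point $x\in X$: - a $cn$-network if for each neighborhood $O_x$ of $x$ the set $\bigcup\{N\in\mathcal N: x\in N\subset O_x\}$ is a neighborhood of $x$; - a $ck$-network if for any neighborhood $O_x$ of $x$ there is a neighborhood $U_x$ of $x$ such that for each compact $K\subset U_x$ there is a finite $\mathcal F\subset\mathcal N$ with $x\in\bigcap\mathcal F$ and $K\subset\bigcup\mathcal F\subset O_x$; - a $cp$-network if either $x$ is isolated in $X$ and $\{x\}\in\mathcal N$, or for each $A\subset X$ with $x\in\overline A\setminus A$ and each neighborhood $O_x$ of $x$ there is $N\in\mathcal N$ with $x\in N\subset O_x$ and $N\cap A$ infinite. It is such a network in $X$ if it is one at each point of $X$. A family is $\sigma$-locally finite if it is a countable union of locally finite families. A regular space is a $\mathfrak{P}$-space, an $\aleph$-space, a strict $\aleph$-space, or a strict $\sigma$-space if it has a $\sigma$-locally finite $cp$-network, $k$-network,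 $ck$-network, or $cn$-network, respectively. $X$ has countable fan tightness if for each $x\in X$ and all sets $A_n\subset X$, $n\in\mathbb N$, with $x\in\bigcap_n\overline{A_n}$ there are finite sets $F_n\subset A_n$ with $x\in\overline{\bigcup_n F_n}$. $X$ is Fréchet–Urysohn if whenever $x\in\overline A$, $A\subset X$, there is a sequence in $A$ converging to $x$. $X$ is an $(\alpha_4)$-space if for each $x\in X$ and any $\{x_{m,n}:(m,n)\in\mathbb N\times\mathbb N\}\subset X$ with $\lim_n x_{m,n}=x$ for every $m\in\mathbb N$, there are a sequence $(m_k)_k$ of distinct natural numbers and a sequence $(n_k)_k$ of natural numbers with $\lim_k x_{m_k,n_k}=x$. $X$ is an $M$-space if there is a sequence $\{\mathcal U_n\}_{n\in\mathbb N}$ of open covers of $X$ such that: for every $x\in X$, if $x_n\in\bigcup\{U\in\mathcal U_n: x\in U\}$ for each $n$, then $\{x_n\}_{n\in\mathbb N}$ has a cluster point; and for each $n$, $\mathcal U_{n+1}$ star refines $\mathcal U_n$.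
   Formalization: In the definition of a cp-network, the "either … or" is read by cases: at every isolated point x the family must contain {x}. Read as a plain disjunction it asks nothing at isolated points, and (ii)⇒(i) then fails for the Michael line. *)

theory Defs
  imports "HOL-Analysis.Analysis"
begin

definition neighbourhood_in :: "'a topology \<Rightarrow> 'a \<Rightarrow> 'a set \<Rightarrow> bool" where
  "neighbourhood_in X x S \<longleftrightarrow>
     S \<subseteq> topspace X \<and> (\<exists>U. openin X U \<and> x \<in> U \<and> U \<subseteq> S)"

definition isolated_point_in :: "'a topology \<Rightarrow> 'a \<Rightarrow> bool" where
  "isolated_point_in X x \<longleftrightarrow> openin X {x}"

subsection \<open>Networks\<close>

definition k_network_in :: "'a topology \<Rightarrow> 'a set set \<Rightarrow> bool" where
  "k_network_in X \<N> \<longleftrightarrow>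
     \<N> \<subseteq> Pow (topspace X) \<and>
     (\<forall>K U. compactin X K \<and> openin X U \<and> K \<subseteq> U \<longrightarrow>
        (\<exists>\<F>. finite \<F> \<and> \<F> \<subseteq> \<N> \<and> K \<subseteq> \<Union>\<F> \<and> \<Union>\<F> \<subseteq> U))"

definition cn_network_at :: "'a topology \<Rightarrow> 'a set set \<Rightarrow> 'a \<Rightarrow> bool" where
  "cn_network_at X \<N> x \<longleftrightarrow>
     (\<forall>O\<^sub>x. neighbourhood_in X x O\<^sub>x \<longrightarrow>
        neighbourhood_in X x (\<Union>{N \<in> \<N>. x \<in> N \<and> N \<subseteq> O\<^sub>x}))"

definition ck_network_at :: "'a topology \<Rightarrow> 'a set set \<Rightarrow> 'a \<Rightarrow> bool" where
  "ck_network_at X \<N> x \<longleftrightarrow>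
     (\<forall>O\<^sub>x. neighbourhood_in X x O\<^sub>x \<longrightarrow>
        (\<exists>U\<^sub>x. neighbourhood_in X x U\<^sub>x \<and>
           (\<forall>K. compactin X K \<and> K \<subseteq> U\<^sub>x \<longrightarrow>
              (\<exists>\<F>. finite \<F> \<and> \<F> \<subseteq> \<N> \<and> x \<in> \<Inter>\<F> \<and> K \<subseteq> \<Union>\<F> \<and> \<Union>\<F> \<subseteq> O\<^sub>x))))"

text \<open>
  The ``either ... or'' in the definition of a cp-network is the case distinction on whether
  \<open>x\<close> is isolated. As an inclusive disjunction it would impose nothing at an isolated point,
  since no \<open>A\<close> has such a point in its closure but not in \<open>A\<close> itself.
\<close>

definition cp_network_at :: "'a topology \<Rightarrow> 'a set set \<Rightarrow> 'a \<Rightarrow> bool" where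
  "cp_network_at X \<N> x \<longleftrightarrow>
     (if isolated_point_in X x then {x} \<in> \<N>
      else \<forall>A O\<^sub>x. A \<subseteq> topspace X \<and> x \<in> X closure_of A - A \<and> neighbourhood_in X x O\<^sub>x \<longrightarrow>
             (\<exists>N\<in>\<N>. x \<in> N \<and> N \<subseteq> O\<^sub>x \<and> infinite (N \<inter> A)))"

definition cn_network_in :: "'a topology \<Rightarrow> 'a set set \<Rightarrow> bool" where
  "cn_network_in X \<N> \<longleftrightarrow>
     \<N> \<subseteq> Pow (topspace X) \<and> (\<forall>x \<in> topspace X. cn_network_at X \<N> x)"

definition ck_network_in :: "'a topology \<Rightarrow> 'a set set \<Rightarrow> bool" where
  "ck_network_in X \<N> \<longleftrightarrow>
     \<N> \<subseteq> Pow (topspace X) \<and> (\<forall>x \<in> topspace X. ck_network_at X \<N> x)"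

definition cp_network_in :: "'a topology \<Rightarrow> 'a set set \<Rightarrow> bool" where
  "cp_network_in X \<N> \<longleftrightarrow>
     \<N> \<subseteq> Pow (topspace X) \<and> (\<forall>x \<in> topspace X. cp_network_at X \<N> x)"

definition sigma_locally_finite_in :: "'a topology \<Rightarrow> 'a set set \<Rightarrow> bool" where
  "sigma_locally_finite_in X \<N> \<longleftrightarrow>
     (\<exists>\<A> :: nat \<Rightarrow> 'a set set. (\<forall>n. locally_finite_in X (\<A> n)) \<and> \<N> = (\<Union>n. \<A> n))"

text \<open>
  The library's \<^const>\<open>regular_space\<close> does not include the Hausdorff axiom. The Hausdorff
  property, a standing assumption on all spaces here, is not repeated in the following
  definitions; it has to be assumed separately.
\<close>

definition P_space :: "'a topology \<Rightarrow> bool" where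
  "P_space X \<longleftrightarrow>
     regular_space X \<and> (\<exists>\<N>. sigma_locally_finite_in X \<N> \<and> cp_network_in X \<N>)"

definition aleph_space :: "'a topology \<Rightarrow> bool" where
  "aleph_space X \<longleftrightarrow>
     regular_space X \<and> (\<exists>\<N>. sigma_locally_finite_in X \<N> \<and> k_network_in X \<N>)"

definition strict_aleph_space :: "'a topology \<Rightarrow> bool" where
  "strict_aleph_space X \<longleftrightarrow>
     regular_space X \<and> (\<exists>\<N>. sigma_locally_finite_in X \<N> \<and> ck_network_in X \<N>)"

definition strict_sigma_space :: "'a topology \<Rightarrow> bool" where
  "strict_sigma_space X \<longleftrightarrow>
     regular_space X \<and> (\<exists>\<N>. sigma_locally_finite_in X \<N> \<and> cn_network_in X \<N>)"

subsection \<open>Convergence-type properties\<close>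

definition countable_fan_tightness :: "'a topology \<Rightarrow> bool" where
  "countable_fan_tightness X \<longleftrightarrow>
     (\<forall>x \<in> topspace X. \<forall>A :: nat \<Rightarrow> 'a set.
        (\<forall>n. A n \<subseteq> topspace X) \<and> x \<in> (\<Inter>n. X closure_of A n) \<longrightarrow>
        (\<exists>F :: nat \<Rightarrow> 'a set.
           (\<forall>n. finite (F n) \<and> F n \<subseteq> A n) \<and> x \<in> X closure_of (\<Union>n. F n)))"

definition frechet_urysohn_space :: "'a topology \<Rightarrow> bool" where
  "frechet_urysohn_space X \<longleftrightarrow>
     (\<forall>A x. A \<subseteq> topspace X \<and> x \<in> X closure_of A \<longrightarrow>
        (\<exists>s :: nat \<Rightarrow> 'a. (\<forall>n. s n \<in> A) \<and> limitin X s x sequentially))"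

definition alpha4_space :: "'a topology \<Rightarrow> bool" where
  "alpha4_space X \<longleftrightarrow>
     (\<forall>x \<in> topspace X. \<forall>s :: nat \<Rightarrow> nat \<Rightarrow> 'a.
        (\<forall>m n. s m n \<in> topspace X) \<and> (\<forall>m. limitin X (\<lambda>n. s m n) x sequentially) \<longrightarrow>
        (\<exists>m n :: nat \<Rightarrow> nat. inj m \<and> limitin X (\<lambda>k. s (m k) (n k)) x sequentially))"

subsection \<open>M-spaces\<close>

definition open_cover_of :: "'a topology \<Rightarrow> 'a set set \<Rightarrow> bool" where
  "open_cover_of X \<U> \<longleftrightarrow> (\<forall>U\<in>\<U>. openin X U) \<and> \<Union>\<U> = topspace X"

definition star_refines :: "'a set set \<Rightarrow> 'a set set \<Rightarrow> bool" where
  "star_refines \<V> \<U> \<longleftrightarrow> (\<forall>V\<in>\<V>. \<exists>U\<in>\<U>. \<Union>{W \<in> \<V>. W \<inter> V \<noteq> {}} \<subseteq> U)"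

text \<open>
  A cluster point of the sequence, not of its range: a constant sequence clusters at its value.
\<close>

definition seq_cluster_point :: "'a topology \<Rightarrow> (nat \<Rightarrow> 'a) \<Rightarrow> 'a \<Rightarrow> bool" where
  "seq_cluster_point X s p \<longleftrightarrow>
     p \<in> topspace X \<and> (\<forall>U. openin X U \<and> p \<in> U \<longrightarrow> infinite {n. s n \<in> U})"

definition M_space :: "'a topology \<Rightarrow> bool" where
  "M_space X \<longleftrightarrow>
     (\<exists>\<U> :: nat \<Rightarrow> 'a set set.
        (\<forall>n. open_cover_of X (\<U> n)) \<and>
        (\<forall>x \<in> topspace X. \<forall>s :: nat \<Rightarrow> 'a.
           (\<forall>n. s n \<in> \<Union>{U \<in> \<U> n. x \<in> U}) \<longrightarrow> (\<exists>p. seq_cluster_point X s p)) \<and>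
        (\<forall>n. star_refines (\<U> (Suc n)) (\<U> n)))"

end

theory Submission
  imports Defs
begin

text \<open>
  Every converse is reduced to the Nagata-Smirnov theorem. A regular space is metrizable as soon
  as it has locally finite closed families \<open>\<N> 0 \<subseteq> \<N> 1 \<subseteq> \<dots>\<close> such that each neighbourhood \<open>U\<close> of
  a point \<open>x\<close> admits an \<open>n\<close> for which the union of those \<open>N \<in> \<N> n\<close> with \<open>x \<in> N \<subseteq> U\<close> is a
  neighbourhood of \<open>x\<close>: a set \<open>S\<close> has the decreasing open expansions obtained by removing all
  members of \<open>\<N> n\<close> disjoint from \<open>S\<close>; they give normality and a \<open>\<sigma>\<close>-locally finite base. If the
  condition failed at \<open>x\<close>, countable fan tightness, or a sequence provided by the Frechet-Urysohn
  and \<open>(\<alpha>\<^sub>4)\<close> properties, would escape all these unions and contradict the network property.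

  In an M-space, Stone's construction applied to the star-refining covers gives \<open>\<sigma>\<close>-locally finite
  refinements of them. Any sequence trapped in the stars of \<open>x\<close> clusters, and a \<open>\<sigma>\<close>-locally finite
  closed network yields further covers that force the cluster point to be \<open>x\<close>, so that finite
  intersections of members of all these covers form a base. Stone's construction for the covers
  by balls of radius \<open>3\<^sup>-\<^sup>n\<close> also provides the base of a metrizable space.
\<close>

subsection \<open>Locally finite families\<close>

lemma locally_finite_inD:
  assumes "locally_finite_in X \<A>" "x \<in> topspace X"
  obtains V where "openin X V" "x \<in> V" "finite {A \<in> \<A>. A \<inter> V \<noteq> {}}"
  using assms unfolding locally_finite_in_def by blast

lemma locally_finite_in_point_finite:
  assumes "locally_finite_in X \<A>"
  shows "finite {A \<in> \<A>. x \<in> A}"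
proof (cases "x \<in> topspace X")
  case True
  obtain V where "x \<in> V" and fin: "finite {A \<in> \<A>. A \<inter> V \<noteq> {}}"
    using locally_finite_inD [OF assms True] .
  show ?thesis
    by (rule finite_subset [OF _ fin]) (use \<open>x \<in> V\<close> in auto)
next
  case False
  then have "{A \<in> \<A>. x \<in> A} = {}"
    using assms by (auto simp: locally_finite_in_def)
  then show ?thesis by (metis finite.emptyI)
qed

lemma locally_finite_in_Un:
  assumes "locally_finite_in X \<A>" "locally_finite_in X \<B>"
  shows "locally_finite_in X (\<A> \<union> \<B>)"
  unfolding locally_finite_in_def
proof (intro conjI ballI)
  show "\<Union>(\<A> \<union> \<B>) \<subseteq> topspace X"
    using assms by (auto simp: locally_finite_in_def)
next
  fix x assume x: "x \<in> topspace X"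
  obtain V where V: "openin X V" "x \<in> V" "finite {A \<in> \<A>. A \<inter> V \<noteq> {}}"
    using locally_finite_inD [OF assms(1) x] .
  obtain W where W: "openin X W" "x \<in> W" "finite {A \<in> \<B>. A \<inter> W \<noteq> {}}"
    using locally_finite_inD [OF assms(2) x] .
  have "finite {A \<in> \<A> \<union> \<B>. A \<inter> (V \<inter> W) \<noteq> {}}"
    by (rule finite_subset [OF _ finite_UnI [OF V(3) W(3)]]) auto
  with V W show "\<exists>V. openin X V \<and> x \<in> V \<and> finite {A \<in> \<A> \<union> \<B>. A \<inter> V \<noteq> {}}"
    by (intro exI [of _ "V \<inter> W"]) auto
qed

lemma locally_finite_in_UN_atMost:
  fixes n :: nat
  assumes "\<And>i. locally_finite_in X (\<A> i)"
  shows "locally_finite_in X (\<Union>i\<le>n. \<A> i)"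
  by (induction n) (auto simp: assms atMost_Suc intro: locally_finite_in_Un)

text \<open>A neighbourhood that meets only finitely many \<open>W\<close> can meet only members of
  the finite families \<open>\<G> W\<close> of those \<open>W\<close>, since each such member lies
  in its \<open>W\<close>. This allows the members of a refinement to be cut into finitely many
  pieces each.\<close>

lemma locally_finite_in_UN_finite:
  assumes "locally_finite_in X \<W>"
    and fin: "\<And>W. W \<in> \<W> \<Longrightarrow> finite (\<G> W)"
    and sub: "\<And>W G. \<lbrakk>W \<in> \<W>; G \<in> \<G> W\<rbrakk> \<Longrightarrow> G \<subseteq> W"
  shows "locally_finite_in X (\<Union>W\<in>\<W>. \<G> W)"
  unfolding locally_finite_in_def
proof (intro conjI ballI)
  show "\<Union>(\<Union>W\<in>\<W>. \<G> W) \<subseteq> topspace X"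
    using assms(1) sub unfolding locally_finite_in_def by fastforce
next
  fix x assume x: "x \<in> topspace X"
  obtain V where V: "openin X V" "x \<in> V" "finite {W \<in> \<W>. W \<inter> V \<noteq> {}}"
    using locally_finite_inD [OF assms(1) x] .
  have "{G \<in> (\<Union>W\<in>\<W>. \<G> W). G \<inter> V \<noteq> {}} \<subseteq> (\<Union>W\<in>{W \<in> \<W>. W \<inter> V \<noteq> {}}. \<G> W)"
    using sub by blast
  then have "finite {G \<in> (\<Union>W\<in>\<W>. \<G> W). G \<inter> V \<noteq> {}}"
    using V(3) fin by (elim finite_subset) auto
  with V show "\<exists>V. openin X V \<and> x \<in> V \<and> finite {G \<in> (\<Union>W\<in>\<W>. \<G> W). G \<inter> V \<noteq> {}}"
    by blast
qed

lemma locally_finite_in_Int: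
  assumes "locally_finite_in X \<A>" "locally_finite_in X \<B>"
  shows "locally_finite_in X {A \<inter> B |A B. A \<in> \<A> \<and> B \<in> \<B>}"
  unfolding locally_finite_in_def
proof (intro conjI ballI)
  show "\<Union>{A \<inter> B |A B. A \<in> \<A> \<and> B \<in> \<B>} \<subseteq> topspace X"
    using assms by (auto simp: locally_finite_in_def)
next
  fix x assume x: "x \<in> topspace X"
  obtain V where V: "openin X V" "x \<in> V" "finite {A \<in> \<A>. A \<inter> V \<noteq> {}}"
    using locally_finite_inD [OF assms(1) x] .
  obtain W where W: "openin X W" "x \<in> W" "finite {A \<in> \<B>. A \<inter> W \<noteq> {}}"
    using locally_finite_inD [OF assms(2) x] .
  have "{C \<in> {A \<inter> B |A B. A \<in> \<A> \<and> B \<in> \<B>}. C \<inter> (V \<inter> W) \<noteq> {}}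
        \<subseteq> (\<lambda>(A, B). A \<inter> B) ` ({A \<in> \<A>. A \<inter> V \<noteq> {}} \<times> {B \<in> \<B>. B \<inter> W \<noteq> {}})"
    by fastforce
  then have "finite {C \<in> {A \<inter> B |A B. A \<in> \<A> \<and> B \<in> \<B>}. C \<inter> (V \<inter> W) \<noteq> {}}"
    using V(3) W(3) by (meson finite_SigmaI finite_imageI finite_subset)
  with V W show "\<exists>V. openin X V \<and> x \<in> V \<and>
      finite {C \<in> {A \<inter> B |A B. A \<in> \<A> \<and> B \<in> \<B>}. C \<inter> V \<noteq> {}}"
    by (intro exI [of _ "V \<inter> W"]) auto
qed

lemma locally_finite_imp_sigma_locally_finite_in:
  "locally_finite_in X \<A> \<Longrightarrow> sigma_locally_finite_in X \<A>"
  unfolding sigma_locally_finite_in_def by (intro exI [of _ "\<lambda>_. \<A>"]) simp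

lemma sigma_locally_finite_in_UN:
  assumes "countable I" and slf: "\<And>i. i \<in> I \<Longrightarrow> sigma_locally_finite_in X (\<A> i)"
  shows "sigma_locally_finite_in X (\<Union>i\<in>I. \<A> i)"
proof (cases "I = {}")
  case True
  then show ?thesis
    by (simp add: finite_imp_locally_finite_in locally_finite_imp_sigma_locally_finite_in)
next
  case False
  have "\<exists>g. (\<forall>n::nat. locally_finite_in X (g n)) \<and> \<A> i = (\<Union>n. g n)" if "i \<in> I" for i
    using slf [OF that] by (simp add: sigma_locally_finite_in_def)
  then obtain g where g: "\<And>i n. i \<in> I \<Longrightarrow> locally_finite_in X (g i (n::nat))"
    and Ag: "\<And>i. i \<in> I \<Longrightarrow> \<A> i = (\<Union>n. g i n)"
    by metis
  \<comment> \<open>The number \<open>k\<close> codes a pair: its first component selects the index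
    in \<open>I\<close>, its second the stage of the corresponding decomposition. The enumeration of
    \<open>I\<close> is meaningful only for nonempty \<open>I\<close>, hence the case split.\<close>
  define h where "h k = g (from_nat_into I (fst (prod_decode k))) (snd (prod_decode k))" for k
  have "locally_finite_in X (h k)" for k
    using False by (simp add: h_def g from_nat_into)
  moreover have "(\<Union>i\<in>I. \<A> i) = (\<Union>k. h k)"
  proof
    show "(\<Union>k. h k) \<subseteq> (\<Union>i\<in>I. \<A> i)"
      using False by (fastforce simp: h_def Ag intro: from_nat_into)
    show "(\<Union>i\<in>I. \<A> i) \<subseteq> (\<Union>k. h k)"
    proof clarify
      fix i A assume "i \<in> I" "A \<in> \<A> i"
      then obtain n where n: "A \<in> g i n"
        using Ag by blast
      obtain m where m: "from_nat_into I m = i"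
        using \<open>i \<in> I\<close> \<open>countable I\<close> by (meson from_nat_into_to_nat_on)
      have "A \<in> h (prod_encode (m, n))"
        by (simp add: h_def m n)
      then show "A \<in> (\<Union>k. h k)"
        by blast
    qed
  qed
  ultimately show ?thesis
    unfolding sigma_locally_finite_in_def by blast
qed

lemma sigma_locally_finite_in_Int:
  assumes "sigma_locally_finite_in X \<A>" "sigma_locally_finite_in X \<B>"
  shows "sigma_locally_finite_in X {A \<inter> B |A B. A \<in> \<A> \<and> B \<in> \<B>}"
proof -
  obtain f where f: "\<And>n::nat. locally_finite_in X (f n)" "\<A> = (\<Union>n. f n)"
    using assms(1) by (auto simp: sigma_locally_finite_in_def)
  obtain g where g: "\<And>n::nat. locally_finite_in X (g n)" "\<B> = (\<Union>n. g n)"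
    using assms(2) by (auto simp: sigma_locally_finite_in_def)
  have "{A \<inter> B |A B. A \<in> \<A> \<and> B \<in> \<B>} = (\<Union>(i,j)\<in>UNIV. {A \<inter> B |A B. A \<in> f i \<and> B \<in> g j})"
    unfolding f g by auto
  moreover have "sigma_locally_finite_in X (\<Union>(i,j)\<in>UNIV. {A \<inter> B |A B. A \<in> f i \<and> B \<in> g j})"
    by (rule sigma_locally_finite_in_UN)
      (auto intro!: locally_finite_imp_sigma_locally_finite_in locally_finite_in_Int f g)
  ultimately show ?thesis
    by simp
qed

lemma sigma_locally_finite_in_subset:
  assumes "sigma_locally_finite_in X \<A>" "\<B> \<subseteq> \<A>"
  shows "sigma_locally_finite_in X \<B>"
proof -
  obtain f where f: "\<And>n::nat. locally_finite_in X (f n)" "\<A> = (\<Union>n. f n)"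
    using assms(1) by (auto simp: sigma_locally_finite_in_def)
  then have "\<B> = (\<Union>n. f n \<inter> \<B>)" and "\<And>n. locally_finite_in X (f n \<inter> \<B>)"
    using assms(2) by (auto intro: locally_finite_in_subset)
  then show ?thesis
    unfolding sigma_locally_finite_in_def by (intro exI [of _ "\<lambda>n. f n \<inter> \<B>"]) simp
qed

lemma sigma_locally_finite_in_UN_finite:
  assumes "sigma_locally_finite_in X \<W>"
    and fin: "\<And>W. W \<in> \<W> \<Longrightarrow> finite (\<G> W)"
    and sub: "\<And>W G. \<lbrakk>W \<in> \<W>; G \<in> \<G> W\<rbrakk> \<Longrightarrow> G \<subseteq> W"
  shows "sigma_locally_finite_in X (\<Union>W\<in>\<W>. \<G> W)"
proof -
  obtain f where f: "\<And>n::nat. locally_finite_in X (f n)" "\<W> = (\<Union>n. f n)"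
    using assms(1) by (auto simp: sigma_locally_finite_in_def)
  have "locally_finite_in X (\<Union>W\<in>f n. \<G> W)" for n
    by (rule locally_finite_in_UN_finite [OF f(1)]) (use f(2) fin sub in blast)+
  moreover have "(\<Union>W\<in>\<W>. \<G> W) = (\<Union>n. \<Union>W\<in>f n. \<G> W)"
    using f by blast
  ultimately show ?thesis
    unfolding sigma_locally_finite_in_def by (intro exI [of _ "\<lambda>n. \<Union>W\<in>f n. \<G> W"]) simp
qed

subsection \<open>Normal sequences of covers\<close>

definition point_star :: "'a set set \<Rightarrow> 'a \<Rightarrow> 'a set" where
  "point_star \<U> x = \<Union>{U \<in> \<U>. x \<in> U}"

text \<open>The stars of a point behave like balls around it whose radius shrinks with
  \<open>n\<close>: they are symmetric, and two steps at level \<open>Suc n\<close> amount to at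
  most one step at level \<open>n\<close>.\<close>

locale normal_cover_sequence =
  fixes X :: "'a topology" and \<U> :: "nat \<Rightarrow> 'a set set"
  assumes open_cover: "\<And>n. open_cover_of X (\<U> n)"
    and star_refines: "\<And>n. star_refines (\<U> (Suc n)) (\<U> n)"
begin

lemma openin_cover: "U \<in> \<U> n \<Longrightarrow> openin X U"
  using open_cover by (auto simp: open_cover_of_def)

lemma cover_obtain:
  assumes "x \<in> topspace X"
  obtains U where "U \<in> \<U> n" "x \<in> U"
proof -
  have "x \<in> \<Union>(\<U> n)"
    using open_cover [of n] assms unfolding open_cover_of_def by blast
  then show thesis
    using that by blast
qed

text \<open>The sets \<open>A\<close>, \<open>C\<close> and \<open>Z\<close> itself all meet the
  middle set \<open>Z\<close>, so the star of \<open>Z\<close> contains all three. This takes the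
  place of the triangle inequality, at the cost of one level.\<close>

lemma two_step:
  assumes "A \<in> \<U> (Suc n)" "Z \<in> \<U> (Suc n)" "C \<in> \<U> (Suc n)" "A \<inter> Z \<noteq> {}" "C \<inter> Z \<noteq> {}"
  shows "\<exists>B\<in>\<U> n. A \<subseteq> B \<and> Z \<subseteq> B \<and> C \<subseteq> B"
proof -
  have "\<exists>B\<in>\<U> n. \<Union>{W \<in> \<U> (Suc n). W \<inter> Z \<noteq> {}} \<subseteq> B"
    using star_refines [of n] assms(2) by (simp add: star_refines_def)
  moreover have "Z \<inter> Z \<noteq> {}"
    using assms(4) by blast
  ultimately show ?thesis
    using assms by (elim bexE, intro bexI conjI) (auto dest: subsetD)
qed

lemma point_star_Suc: "point_star (\<U> (Suc n)) x \<subseteq> point_star (\<U> n) x"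
proof
  fix y assume "y \<in> point_star (\<U> (Suc n)) x"
  then obtain A where "A \<in> \<U> (Suc n)" "x \<in> A" "y \<in> A"
    by (auto simp: point_star_def)
  moreover from this have "\<exists>B\<in>\<U> n. A \<subseteq> B \<and> A \<subseteq> B \<and> A \<subseteq> B"
    by (intro two_step) auto
  ultimately show "y \<in> point_star (\<U> n) x"
    by (auto simp: point_star_def)
qed

lemma point_star_antimono: "m \<le> n \<Longrightarrow> point_star (\<U> n) x \<subseteq> point_star (\<U> m) x"
  by (rule lift_Suc_antimono_le [of "\<lambda>n. point_star (\<U> n) x"]) (rule point_star_Suc)

lemma openin_point_star: "openin X (point_star (\<U> n) x)"
  unfolding point_star_def using openin_cover by blast

lemma point_star_trans:
  assumes "y \<in> point_star (\<U> (Suc n)) x" "z \<in> point_star (\<U> (Suc n)) y"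
  shows "z \<in> point_star (\<U> n) x"
proof -
  obtain A B where "A \<in> \<U> (Suc n)" "x \<in> A" "y \<in> A" "B \<in> \<U> (Suc n)" "y \<in> B" "z \<in> B"
    using assms by (auto simp: point_star_def)
  moreover from this have "\<exists>C\<in>\<U> n. A \<subseteq> C \<and> A \<subseteq> C \<and> B \<subseteq> C"
    by (intro two_step) auto
  ultimately show ?thesis
    by (auto simp: point_star_def)
qed

lemma point_star_sym: "y \<in> point_star (\<U> n) x \<longleftrightarrow> x \<in> point_star (\<U> n) y"
  by (auto simp: point_star_def)

lemma point_star_refl: "x \<in> topspace X \<Longrightarrow> x \<in> point_star (\<U> n) x"
  using cover_obtain [of x n] by (auto simp: point_star_def)

text \<open>The star of a closure point \<open>y\<close> is an open neighbourhood of
  \<open>y\<close>, so it meets the star of \<open>x\<close>; a common point links \<open>x\<close>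
  to \<open>y\<close> by two steps of level \<open>Suc n\<close>.\<close>

lemma closure_of_point_star: "X closure_of (point_star (\<U> (Suc n)) x) \<subseteq> point_star (\<U> n) x"
proof
  fix y assume y: "y \<in> X closure_of (point_star (\<U> (Suc n)) x)"
  then have "y \<in> topspace X"
    by (simp add: in_closure_of)
  then have "y \<in> point_star (\<U> (Suc n)) y"
    by (rule point_star_refl)
  then obtain z where "z \<in> point_star (\<U> (Suc n)) x" "z \<in> point_star (\<U> (Suc n)) y"
    using y openin_point_star unfolding in_closure_of by blast
  then show "y \<in> point_star (\<U> n) x"
    by (metis point_star_sym point_star_trans)
qed

text \<open>
  Stone's construction, with the members of the cover well-ordered and the stars with respect to
  later covers in the role of small balls.
\<close>

proposition sigma_locally_finite_refinement:
  obtains \<W> where "sigma_locally_finite_in X \<W>" "\<And>W. W \<in> \<W> \<Longrightarrow> openin X W"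
    "\<Union>\<W> = topspace X" "\<And>W. W \<in> \<W> \<Longrightarrow> \<exists>U\<in>\<U> m. W \<subseteq> U"
proof -
  obtain r0 :: "'a set rel" where r0: "well_order_on UNIV r0"
    using well_order_on by blast
  define r where "r = r0 - Id"
  have wfr: "wf r" and tot: "\<And>a b. a \<noteq> b \<Longrightarrow> (a, b) \<in> r \<or> (b, a) \<in> r"
    using r0 by (auto simp: r_def well_order_on_def linear_order_on_def total_on_def)
  \<comment> \<open>\<open>S n V\<close> is the part of \<open>V\<close> that stays at depth
    \<open>n\<close> away from its complement. \<open>S' n U\<close> discards whatever lies at some
    depth in an earlier member of the cover, and \<open>E n U\<close> fattens the rest to an open
    set.\<close>
  define S where "S n V = {x \<in> topspace X. point_star (\<U> n) x \<subseteq> V}" for n V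
  define S' where "S' n U = S n U - (\<Union>V\<in>{V \<in> \<U> m. (V, U) \<in> r}. \<Union>k. S k V)" for n U
  define E where "E n U = \<Union>{A \<in> \<U> (Suc (Suc n)). A \<inter> S' n U \<noteq> {}}" for n U
  \<comment> \<open>If \<open>y\<close> were in this star of \<open>x\<close>, its own star at level
    \<open>Suc n\<close> would lie in \<open>V\<close>, so that \<open>y\<close> would belong to
    \<open>S (Suc n) V\<close>, which was discarded from \<open>S' n U\<close>.\<close>
  have separated: "y \<notin> point_star (\<U> (Suc n)) x"
    if xy: "x \<in> S' n V" "y \<in> S' n U" and VU: "V \<in> \<U> m" "(V, U) \<in> r" for n U V x y
  proof
    assume y: "y \<in> point_star (\<U> (Suc n)) x"
    have "point_star (\<U> (Suc n)) y \<subseteq> point_star (\<U> n) x"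
      using point_star_trans [OF y] by blast
    also have "\<dots> \<subseteq> V"
      using xy by (auto simp: S'_def S_def)
    finally have "y \<in> S (Suc n) V"
      using xy by (auto simp: S'_def S_def)
    then show False
      using xy VU by (auto simp: S'_def)
  qed
  \<comment> \<open>Two fattened sets meeting the same \<open>Z\<close> are joined by a chain
    \<open>A\<close>, \<open>Z\<close>, \<open>B\<close>, which fits into one member of level
    \<open>Suc n\<close>. Of the two extra levels in \<open>E\<close>, one is spent here and the
    other in \<open>separated\<close>.\<close>
  have uniq: "U = V"
    if Z: "Z \<in> \<U> (Suc (Suc n))" and UV: "U \<in> \<U> m" "V \<in> \<U> m"
      and ne: "E n U \<inter> Z \<noteq> {}" "E n V \<inter> Z \<noteq> {}" for n U V Z
  proof (rule ccontr)
    assume "U \<noteq> V"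
    obtain A x where A: "A \<in> \<U> (Suc (Suc n))" "A \<inter> Z \<noteq> {}" "x \<in> A" "x \<in> S' n U"
      using ne by (auto simp: E_def)
    obtain B y where B: "B \<in> \<U> (Suc (Suc n))" "B \<inter> Z \<noteq> {}" "y \<in> B" "y \<in> S' n V"
      using ne by (auto simp: E_def)
    have "\<exists>C\<in>\<U> (Suc n). A \<subseteq> C \<and> Z \<subseteq> C \<and> B \<subseteq> C"
      using A B Z by (intro two_step)
    then have "y \<in> point_star (\<U> (Suc n)) x" "x \<in> point_star (\<U> (Suc n)) y"
      using A B by (auto simp: point_star_def)
    then show False
      using tot [OF \<open>U \<noteq> V\<close>] separated A B UV by blast
  qed
  have E_sub: "E n U \<subseteq> U" for n U
  proof
    fix z assume "z \<in> E n U"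
    then obtain A x where "A \<in> \<U> (Suc (Suc n))" "z \<in> A" "x \<in> A" "x \<in> S' n U"
      by (auto simp: E_def)
    then have "z \<in> point_star (\<U> (Suc (Suc n))) x" "point_star (\<U> n) x \<subseteq> U"
      by (auto simp: point_star_def S'_def S_def)
    then show "z \<in> U"
      using point_star_antimono [of n "Suc (Suc n)" x] by auto
  qed
  have openE: "openin X (E n U)" for n U
    unfolding E_def using openin_cover by blast
  have lf: "locally_finite_in X (E n ` \<U> m)" for n
    unfolding locally_finite_in_def
  proof (intro conjI ballI)
    show "\<Union>(E n ` \<U> m) \<subseteq> topspace X"
      using openE openin_subset by blast
  next
    fix x assume "x \<in> topspace X"
    then obtain Z where Z: "Z \<in> \<U> (Suc (Suc n))" "x \<in> Z"
      by (rule cover_obtain)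
    have "finite {U \<in> \<U> m. E n U \<inter> Z \<noteq> {}}"
    proof (cases "{U \<in> \<U> m. E n U \<inter> Z \<noteq> {}} = {}")
      case False
      then obtain U where "U \<in> {U \<in> \<U> m. E n U \<inter> Z \<noteq> {}}"
        by blast
      then have "{U \<in> \<U> m. E n U \<inter> Z \<noteq> {}} \<subseteq> {U}"
        using uniq [OF Z(1)] by blast
      then show ?thesis
        using finite_subset by blast
    next
      case True
      then show ?thesis by (metis finite.emptyI)
    qed
    moreover have "{W \<in> E n ` \<U> m. W \<inter> Z \<noteq> {}} \<subseteq> E n ` {U \<in> \<U> m. E n U \<inter> Z \<noteq> {}}"
      by blast
    ultimately have "finite {W \<in> E n ` \<U> m. W \<inter> Z \<noteq> {}}"
      using finite_subset by blast
    then show "\<exists>V. openin X V \<and> x \<in> V \<and> finite {W \<in> E n ` \<U> m. W \<inter> V \<noteq> {}}"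
      using Z openin_cover by blast
  qed
  show thesis
  proof (rule that [of "\<Union>n. E n ` \<U> m"])
    show "sigma_locally_finite_in X (\<Union>n. E n ` \<U> m)"
      unfolding sigma_locally_finite_in_def
      by (intro exI [of _ "\<lambda>n. E n ` \<U> m"]) (simp add: lf)
    show "openin X W" if "W \<in> (\<Union>n. E n ` \<U> m)" for W
      using that openE by blast
    show "\<exists>U\<in>\<U> m. W \<subseteq> U" if "W \<in> (\<Union>n. E n ` \<U> m)" for W
      using that E_sub by blast
    show "\<Union>(\<Union>n. E n ` \<U> m) = topspace X"
    proof
      show "\<Union>(\<Union>n. E n ` \<U> m) \<subseteq> topspace X"
        using openE openin_subset by blast
      show "topspace X \<subseteq> \<Union>(\<Union>n. E n ` \<U> m)"
      proof
        fix x assume x: "x \<in> topspace X"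
        let ?Q = "{U \<in> \<U> m. x \<in> (\<Union>k. S k U)}"
        obtain A where A: "A \<in> \<U> (Suc m)" "x \<in> A"
          using x by (rule cover_obtain)
        obtain B where "B \<in> \<U> m" and B: "\<Union>{W \<in> \<U> (Suc m). W \<inter> A \<noteq> {}} \<subseteq> B"
          using star_refines A unfolding star_refines_def by blast
        have "point_star (\<U> (Suc m)) x \<subseteq> B"
          using B A by (auto simp: point_star_def)
        then have "B \<in> ?Q"
          using \<open>B \<in> \<U> m\<close> x by (auto simp: S_def)
        \<comment> \<open>The first member of the cover in which \<open>x\<close> has some depth: no
          earlier member can then discard \<open>x\<close>, which puts it into
          \<open>S' n U\<close>.\<close>
        obtain U where U: "U \<in> ?Q" and least: "\<And>V. (V, U) \<in> r \<Longrightarrow> V \<notin> ?Q"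
          by (rule wfE_min [OF wfr \<open>B \<in> ?Q\<close>]) (rule that)
        then obtain n where "x \<in> S n U"
          by blast
        with U least have "x \<in> S' n U"
          unfolding S'_def by blast
        moreover obtain C where "C \<in> \<U> (Suc (Suc n))" "x \<in> C"
          using x by (rule cover_obtain)
        ultimately have "x \<in> E n U"
          by (auto simp: E_def)
        then show "x \<in> \<Union>(\<Union>n. E n ` \<U> m)"
          using U by blast
      qed
    qed
  qed
qed

end

subsection \<open>Metrization from locally finite families of functions\<close>

text \<open>The metric is the supremum of all
  \<open>\<bar>\<phi> k i x - \<phi> k i y\<bar> / Suc k\<close>. Through \<open>sep\<close>, open
  sets contain balls; conversely balls are neighbourhoods, because the weights make large
  \<open>k\<close> negligible and local finiteness leaves finitely many functions for each remaining
  \<open>k\<close>.\<close>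

proposition metrizable_space_locally_finite_functions:
  fixes \<phi> :: "nat \<Rightarrow> 'b \<Rightarrow> 'a \<Rightarrow> real"
  assumes "t1_space X"
    and cont: "\<And>k i. i \<in> J k \<Longrightarrow> continuous_map X euclideanreal (\<phi> k i)"
    and range: "\<And>k i x. 0 \<le> \<phi> k i x \<and> \<phi> k i x \<le> 1"
    and lf: "\<And>k x. x \<in> topspace X \<Longrightarrow>
               \<exists>V. openin X V \<and> x \<in> V \<and> finite {i \<in> J k. \<exists>y\<in>V. \<phi> k i y \<noteq> 0}"
    and sep: "\<And>U x. \<lbrakk>openin X U; x \<in> U\<rbrakk> \<Longrightarrow>
               \<exists>k. \<exists>i\<in>J k. \<phi> k i x = 1 \<and> (\<forall>y\<in>topspace X - U. \<phi> k i y = 0)"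
  shows "metrizable_space X"
proof (cases "topspace X = {}")
  case True
  then have "X = trivial_topology"
    by simp
  then show ?thesis
    by simp
next
  case False
  define I where "I = Sigma UNIV J"
  define \<delta> where "\<delta> x y = (\<lambda>(k, i). \<bar>\<phi> k i x - \<phi> k i y\<bar> / real (Suc k))" for x y
  define d where "d x y = (SUP p\<in>I. \<delta> x y p)" for x y
  have "I \<noteq> {}"
  proof -
    obtain x where "x \<in> topspace X"
      using False by blast
    then have "\<exists>k. J k \<noteq> {}"
      using sep [OF openin_topspace] by blast
    then show ?thesis
      by (auto simp: I_def)
  qed
  have \<delta>_bound: "\<delta> x y (k, i) \<le> 1 / real (Suc k)" for x y k i
    unfolding \<delta>_def prod.case using range [of k i x] range [of k i y]
    by (intro divide_right_mono) auto
  have \<delta>_le_1: "\<delta> x y p \<le> 1" for x y p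
  proof (cases p)
    case (Pair k i)
    have "1 / real (Suc k) \<le> 1"
      by simp
    then show ?thesis
      unfolding Pair using \<delta>_bound order_trans by blast
  qed
  have bdd: "bdd_above (\<delta> x y ` I)" for x y
    using \<delta>_le_1 by (auto intro!: bdd_aboveI2)
  have le_d: "\<delta> x y p \<le> d x y" if "p \<in> I" for x y p
    unfolding d_def using bdd that by (rule cSUP_upper2) simp
  have d_le: "d x y \<le> c" if "\<And>p. p \<in> I \<Longrightarrow> \<delta> x y p \<le> c" for x y c
    unfolding d_def using \<open>I \<noteq> {}\<close> that by (rule cSUP_least)
  have \<delta>_nonneg: "0 \<le> \<delta> x y p" for x y p
    by (cases p) (simp add: \<delta>_def)
  have d_nonneg: "0 \<le> d x y" for x y
    using \<open>I \<noteq> {}\<close> \<delta>_nonneg le_d order_trans by (meson ex_in_conv)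
  have small: "y \<in> U" if "openin X U" "x \<in> U" "y \<in> topspace X" "p \<in> I"
      "p = (k, i)" "\<phi> k i x = 1" "\<forall>y\<in>topspace X - U. \<phi> k i y = 0" "d x y < 1 / real (Suc k)"
    for x y U p k i
  proof (rule ccontr)
    assume "y \<notin> U"
    then have "\<delta> x y p = 1 / real (Suc k)"
      using that by (simp add: \<delta>_def)
    then show False
      using le_d [OF \<open>p \<in> I\<close>, of x y] that(8) by simp
  qed
  have separate: "\<exists>r>0. \<forall>y\<in>topspace X. d x y < r \<longrightarrow> y \<in> U" if U: "openin X U" "x \<in> U" for U x
  proof -
    obtain k i where ki: "i \<in> J k" "\<phi> k i x = 1" "\<forall>y\<in>topspace X - U. \<phi> k i y = 0"
      using sep [OF U] by blast
    then have "(k, i) \<in> I"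
      by (simp add: I_def)
    have "\<forall>y\<in>topspace X. d x y < 1 / real (Suc k) \<longrightarrow> y \<in> U"
    proof (intro ballI impI)
      fix y assume "y \<in> topspace X" "d x y < 1 / real (Suc k)"
      then show "y \<in> U"
        by (rule small [OF U _ \<open>(k, i) \<in> I\<close> refl ki(2,3)])
    qed
    then show ?thesis
      by (intro exI [of _ "1 / real (Suc k)"]) simp
  qed
  interpret d: Metric_space "topspace X" d
  proof
    show "0 \<le> d x y" for x y
      by (rule d_nonneg)
    show "d x y = d y x" for x y
    proof -
      have "\<delta> x y = \<delta> y x"
        by (auto simp: \<delta>_def abs_minus_commute)
      then show ?thesis
        by (simp add: d_def)
    qed
    show "d x z \<le> d x y + d y z" for x y z
    proof (rule d_le)
      fix p assume "p \<in> I"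
      have "\<delta> x z p \<le> \<delta> x y p + \<delta> y z p"
        by (cases p) (simp add: \<delta>_def add_divide_distrib [symmetric] divide_right_mono)
      also have "\<dots> \<le> d x y + d y z"
        using le_d \<open>p \<in> I\<close> by (intro add_mono) auto
      finally show "\<delta> x z p \<le> d x y + d y z" .
    qed
    show "d x y = 0 \<longleftrightarrow> x = y" if xy: "x \<in> topspace X" "y \<in> topspace X" for x y
    proof
      assume "d x y = 0"
      show "x = y"
      proof (rule ccontr)
        assume "x \<noteq> y"
        then obtain U where "openin X U" "x \<in> U" "y \<notin> U"
          using \<open>t1_space X\<close> xy unfolding t1_space_def by blast
        then show False
          using separate [of U x] xy \<open>d x y = 0\<close> by auto
      qed
    next
      assume "x = y"
      then have "d x y \<le> 0"
        by (intro d_le) (auto simp: \<delta>_def)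
      then show "d x y = 0"
        using d_nonneg [of x y] by simp
    qed
  qed
  have ball: "\<exists>W. openin X W \<and> x \<in> W \<and> W \<subseteq> d.mball x r" if x: "x \<in> topspace X" and "r > 0" for x r
  proof -
    \<comment> \<open>All terms with \<open>k > n\<close> are below \<open>r / 2\<close> regardless
      of the functions. Half the radius is used because a supremum of terms below a bound need only
      be at most that bound.\<close>
    obtain n where n: "1 / real (Suc n) < r / 2"
      using \<open>r > 0\<close> reals_Archimedean [of "r / 2"] by (auto simp: inverse_eq_divide)
    have "\<exists>V. \<forall>k. openin X (V k) \<and> x \<in> V k \<and> finite {i \<in> J k. \<exists>y\<in>V k. \<phi> k i y \<noteq> 0}"
      using lf [OF x] by (intro choice) blast
    then obtain V where V: "\<And>k. openin X (V k)" "\<And>k. x \<in> V k"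
        "\<And>k. finite {i \<in> J k. \<exists>y\<in>V k. \<phi> k i y \<noteq> 0}"
      by blast
    define A where "A k = {i \<in> J k. \<exists>y\<in>V k. \<phi> k i y \<noteq> 0}" for k
    define T where "T k i = {y \<in> topspace X. \<phi> k i y \<in> {\<phi> k i x - r / 2 <..< \<phi> k i x + r / 2}}"
      for k i
    \<comment> \<open>On \<open>V k\<close> only the functions with index in \<open>A k\<close> can
      be nonzero, and \<open>T k i\<close> controls these. The factor \<open>topspace X\<close>
      makes the inner set open even if \<open>A k\<close> is empty, when the intersection of the
      \<open>T k i\<close> is the whole type.\<close>
    define W where "W = (\<Inter>k\<in>{..n}. V k \<inter> (topspace X \<inter> (\<Inter>i\<in>A k. T k i)))"
    have openT: "openin X (T k i)" if "i \<in> A k" for k i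
      unfolding T_def by (rule openin_continuous_map_preimage [OF cont]) (use that in \<open>auto simp: A_def\<close>)
    have "openin X (topspace X \<inter> (\<Inter>i\<in>A k. T k i))" for k
    proof (cases "A k = {}")
      case False
      then show ?thesis
        using V(3) openT by (intro openin_Int openin_topspace openin_Inter) (auto simp: A_def)
    qed simp
    then have "openin X W"
      unfolding W_def by (intro openin_Inter) (auto intro: V)
    moreover have "x \<in> W"
      using V(2) x \<open>r > 0\<close> by (auto simp: W_def T_def)
    moreover have "W \<subseteq> d.mball x r"
    proof
      fix y assume y: "y \<in> W"
      have "d x y \<le> r / 2"
      proof (rule d_le)
        fix p assume "p \<in> I"
        then obtain k i where p: "p = (k, i)" "i \<in> J k"
          by (auto simp: I_def)
        show "\<delta> x y p \<le> r / 2"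
        proof (cases "k \<le> n")
          case True
          have "\<bar>\<phi> k i x - \<phi> k i y\<bar> \<le> r / 2"
          proof (cases "i \<in> A k")
            case i: True
            then have "y \<in> T k i"
              using y True unfolding W_def by blast
            then show ?thesis
              using \<open>r > 0\<close> unfolding T_def abs_le_iff by auto
          next
            case False
            then have "\<phi> k i x = 0" "\<phi> k i y = 0"
              using True V(2) y p(2) by (auto simp: A_def W_def)
            then show ?thesis
              using \<open>r > 0\<close> by simp
          qed
          moreover have "\<bar>\<phi> k i x - \<phi> k i y\<bar> / real (Suc k) \<le> \<bar>\<phi> k i x - \<phi> k i y\<bar>"
            by (simp add: divide_le_eq distrib_left)
          ultimately show ?thesis
            unfolding \<delta>_def p prod.case by linarith
        next
          case False
          then have "1 / real (Suc k) \<le> 1 / real (Suc n)"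
            by (intro divide_left_mono) auto
          then show ?thesis
            using \<delta>_bound [of x y k i] n by (simp add: p)
        qed
      qed
      moreover have "y \<in> topspace X"
        using y by (auto simp: W_def)
      ultimately show "y \<in> d.mball x r"
        using x \<open>r > 0\<close> by auto
    qed
    ultimately show ?thesis
      by blast
  qed
  have "openin X U \<longleftrightarrow> openin d.mtopology U" for U
  proof
    assume U: "openin X U"
    show "openin d.mtopology U"
      unfolding d.openin_mtopology
    proof (intro conjI allI impI)
      show "U \<subseteq> topspace X"
        using U by (rule openin_subset)
      fix x assume "x \<in> U"
      then show "\<exists>r>0. d.mball x r \<subseteq> U"
        using separate [OF U \<open>x \<in> U\<close>] by (metis d.in_mball subsetI)
    qed
  next
    assume U: "openin d.mtopology U"
    show "openin X U"
    proof (subst openin_subopen, intro ballI)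
      fix x assume "x \<in> U"
      then obtain r where "r > 0" "d.mball x r \<subseteq> U" "x \<in> topspace X"
        using U unfolding d.openin_mtopology by blast
      then show "\<exists>T. openin X T \<and> x \<in> T \<and> T \<subseteq> U"
        using ball [of x r] by (meson order_trans)
    qed
  qed
  then have "X = d.mtopology"
    by (simp add: topology_eq)
  then show ?thesis
    using d.metrizable_space_mtopology by simp
qed

section \<open>Metrics on normal regular spaces with a sigma-locally finite base\<close>

lemma regular_space_closed_neighbourhood:
  assumes "regular_space X" "openin X U" "x \<in> U"
  obtains V where "openin X V" "x \<in> V" "X closure_of V \<subseteq> U"
proof -
  obtain V C where "openin X V" "closedin X C" "x \<in> V" "V \<subseteq> C" "C \<subseteq> U"
    using assms neighbourhood_base_of_closedin [of X] unfolding neighbourhood_base_of by metis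
  then show thesis
    using that [of V] closure_of_minimal by (metis order_trans)
qed

definition open_base_in :: "'a topology \<Rightarrow> 'a set set \<Rightarrow> bool" where
  "open_base_in X \<B> \<longleftrightarrow> (\<forall>B\<in>\<B>. openin X B) \<and>
     (\<forall>U x. openin X U \<and> x \<in> U \<longrightarrow> (\<exists>B\<in>\<B>. x \<in> B \<and> B \<subseteq> U))"

text \<open>For \<open>B\<close> in stage \<open>n\<close> of the base and each \<open>m\<close>,
  Urysohn's lemma gives a function that is 1 on \<open>F m B\<close> and 0 off \<open>B\<close>. The
  supports inherit local finiteness from stage \<open>n\<close>, and regularity places every point
  of \<open>B\<close> in some \<open>F m B\<close>.\<close>

lemma normal_imp_metrizable_space:
  assumes "normal_space X" "regular_space X" "t1_space X"
    and \<B>: "sigma_locally_finite_in X \<B>" "open_base_in X \<B>"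
  shows "metrizable_space X"
proof -
  obtain b where lf: "\<And>n::nat. locally_finite_in X (b n)" and b: "\<B> = (\<Union>n. b n)"
    using \<B>(1) by (auto simp: sigma_locally_finite_in_def)
  \<comment> \<open>A union of closures need not be closed in general; local finiteness of
    \<open>b m\<close> ensures it here.\<close>
  define F where "F m B = \<Union>((\<lambda>S. X closure_of S) ` {B' \<in> b m. X closure_of B' \<subseteq> B})" for m B
  have "closedin X (F m B)" for m B
    unfolding F_def
    by (rule closedin_Union_locally_finite_closure, rule locally_finite_in_subset [OF lf]) auto
  moreover have "F m B \<subseteq> B" for m B
    by (auto simp: F_def)
  note F = calculation this
  have "\<exists>g. continuous_map X (top_of_set {0..1::real}) g \<and>
      g ` (topspace X - B) \<subseteq> {0} \<and> g ` F m B \<subseteq> {1}" if "openin X B" for m B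
  proof -
    have "disjnt (topspace X - B) (F m B)"
      using F(2) [of m B] by (auto simp: disjnt_iff)
    moreover have "closedin X (topspace X - B)"
      using that by blast
    ultimately obtain g where "continuous_map X (top_of_set {0..1::real}) g"
        "g ` (topspace X - B) \<subseteq> {0}" "g ` F m B \<subseteq> {1}"
      using Urysohn_lemma [OF \<open>normal_space X\<close> _ F(1)] zero_le_one by metis
    then show ?thesis
      by blast
  qed
  note ex = this
  define Q where "Q m B g \<longleftrightarrow> continuous_map X (top_of_set {0..1::real}) g \<and>
      g ` (topspace X - B) \<subseteq> {0} \<and> g ` F m B \<subseteq> {1}" for m B g
  define g where "g m B = (SOME g. Q m B g)" for m B
  have "Q m B (g m B)" if "openin X B" for m B
  proof -
    have "\<exists>g. Q m B g"
      unfolding Q_def by (rule ex [OF that])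
    then show ?thesis
      unfolding g_def by (rule someI_ex)
  qed
  then have g_cont: "\<And>m B. openin X B \<Longrightarrow> continuous_map X (top_of_set {0..1::real}) (g m B)"
    and g0: "\<And>m B. openin X B \<Longrightarrow> g m B ` (topspace X - B) \<subseteq> {0}"
    and g1: "\<And>m B. openin X B \<Longrightarrow> g m B ` F m B \<subseteq> {1}"
    by (simp_all add: Q_def)
  \<comment> \<open>The index \<open>k\<close> codes the pair of stages of \<open>B\<close> and of
    the smaller base set. The default 0 off \<open>B\<close>, and for sets that are not open,
    secures the bounds at every argument, even outside the space, where \<open>g\<close> is
    uncontrolled.\<close>
  define \<phi> where "\<phi> k B x = (if openin X B \<and> x \<in> B then g (snd (prod_decode k)) B x else 0)" for k B x
  show ?thesis
  proof (rule metrizable_space_locally_finite_functions [of X "\<lambda>k. b (fst (prod_decode k))" \<phi>])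
    show "t1_space X"
      by fact
    show "continuous_map X euclideanreal (\<phi> k B)" if "B \<in> b (fst (prod_decode k))" for k B
    proof -
      have B: "openin X B"
        using that \<B>(2) by (auto simp: open_base_in_def b)
      then have "continuous_map X euclideanreal (g (snd (prod_decode k)) B)"
        using g_cont continuous_map_in_subtopology by blast
      moreover have "g (snd (prod_decode k)) B x = \<phi> k B x" if "x \<in> topspace X" for x
        using that g0 [OF B, of "snd (prod_decode k)"] B by (auto simp: \<phi>_def)
      ultimately show ?thesis
        by (rule continuous_map_eq)
    qed
    show "0 \<le> \<phi> k B x \<and> \<phi> k B x \<le> 1" for k B x
    proof (cases "openin X B \<and> x \<in> B")
      case True
      then have "x \<in> topspace X"
        using openin_subset by blast
      then show ?thesis
        using True g_cont [of B "snd (prod_decode k)"]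
        by (auto simp: \<phi>_def continuous_map_in_subtopology image_subset_iff)
    qed (auto simp: \<phi>_def)
    show "\<exists>V. openin X V \<and> x \<in> V \<and> finite {B \<in> b (fst (prod_decode k)). \<exists>y\<in>V. \<phi> k B y \<noteq> 0}"
      if x: "x \<in> topspace X" for k x
    proof -
      obtain V where V: "openin X V" "x \<in> V" "finite {B \<in> b (fst (prod_decode k)). B \<inter> V \<noteq> {}}"
        using locally_finite_inD [OF lf x] .
      have "finite {B \<in> b (fst (prod_decode k)). \<exists>y\<in>V. \<phi> k B y \<noteq> 0}"
        by (rule finite_subset [OF _ V(3)]) (auto simp: \<phi>_def)
      then show ?thesis
        using V by blast
    qed
    show "\<exists>k. \<exists>B\<in>b (fst (prod_decode k)). \<phi> k B x = 1 \<and> (\<forall>y\<in>topspace X - U. \<phi> k B y = 0)"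
      if U: "openin X U" "x \<in> U" for U x
    proof -
      obtain B where B: "B \<in> \<B>" "x \<in> B" "B \<subseteq> U"
        using \<B>(2) U unfolding open_base_in_def by metis
      then have "openin X B"
        using \<B>(2) by (auto simp: open_base_in_def)
      then obtain V where V: "openin X V" "x \<in> V" "X closure_of V \<subseteq> B"
        using regular_space_closed_neighbourhood [OF \<open>regular_space X\<close> _ \<open>x \<in> B\<close>] by metis
      obtain B' where B': "B' \<in> \<B>" "x \<in> B'" "B' \<subseteq> V"
        using \<B>(2) V unfolding open_base_in_def by metis
      obtain n m where nm: "B \<in> b n" "B' \<in> b m"
        using B B' b by blast
      have "openin X B'"
        using B' \<B>(2) by (auto simp: open_base_in_def)
      then have "B' \<subseteq> X closure_of B'"
        by (intro closure_of_subset openin_subset)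
      moreover have "X closure_of B' \<subseteq> B"
        using B' V closure_of_mono by blast
      ultimately have "x \<in> F m B"
        using nm B' by (auto simp: F_def)
      then have "\<phi> (prod_encode (n, m)) B x = 1"
        using g1 [OF \<open>openin X B\<close>, of m] \<open>openin X B\<close> B by (auto simp: \<phi>_def)
      moreover have "\<phi> (prod_encode (n, m)) B y = 0" if "y \<in> topspace X - U" for y
        using that B by (auto simp: \<phi>_def)
      moreover have "B \<in> b (fst (prod_decode (prod_encode (n, m))))"
        using nm by simp
      ultimately show ?thesis
        by blast
    qed
  qed
qed

subsection \<open>Closed star networks\<close>

locale closed_star_network =
  fixes X :: "'a topology" and \<N> :: "nat \<Rightarrow> 'a set set"
  assumes locally_finite: "\<And>n. locally_finite_in X (\<N> n)"
    and closed: "\<And>n N. N \<in> \<N> n \<Longrightarrow> closedin X N"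
    and mono_Suc: "\<And>n. \<N> n \<subseteq> \<N> (Suc n)"
    and star: "\<And>U x. \<lbrakk>openin X U; x \<in> U\<rbrakk> \<Longrightarrow>
                 \<exists>n. x \<in> X interior_of \<Union>{N \<in> \<N> n. x \<in> N \<and> N \<subseteq> U}"
begin

definition expansion :: "nat \<Rightarrow> 'a set \<Rightarrow> 'a set" where
  "expansion n S = topspace X - \<Union>{N \<in> \<N> n. N \<inter> S = {}}"

lemma openin_expansion: "openin X (expansion n S)"
  unfolding expansion_def
  by (intro openin_diff openin_topspace closedin_locally_finite_Union
      locally_finite_in_subset [OF locally_finite]) (auto intro: closed)

lemma subset_expansion: "S \<subseteq> topspace X \<Longrightarrow> S \<subseteq> expansion n S"
  by (auto simp: expansion_def)

lemma expansion_antimono: "m \<le> n \<Longrightarrow> expansion n S \<subseteq> expansion m S"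
  using lift_Suc_mono_le [of \<N> m n] mono_Suc by (auto simp: expansion_def)

text \<open>The members of \<open>\<N> n\<close> between \<open>x\<close> and \<open>U\<close> cover
  a neighbourhood \<open>V\<close> of \<open>x\<close>. If \<open>S\<close> misses \<open>U\<close>,
  all of them are removed from the expansion of \<open>S\<close>, which therefore misses
  \<open>V\<close>. It matters that \<open>n\<close> and \<open>V\<close> do not depend on
  \<open>S\<close>.\<close>

lemma expansion_meets:
  assumes "openin X U" "x \<in> U"
  shows "\<exists>n V. openin X V \<and> x \<in> V \<and> (\<forall>S. expansion n S \<inter> V \<noteq> {} \<longrightarrow> S \<inter> U \<noteq> {})"
proof -
  obtain n where n: "x \<in> X interior_of \<Union>{N \<in> \<N> n. x \<in> N \<and> N \<subseteq> U}"
    using star [OF assms] by blast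
  have "S \<inter> U \<noteq> {}" if "expansion n S \<inter> (X interior_of \<Union>{N \<in> \<N> n. x \<in> N \<and> N \<subseteq> U}) \<noteq> {}" for S
  proof -
    have "expansion n S \<inter> \<Union>{N \<in> \<N> n. x \<in> N \<and> N \<subseteq> U} \<noteq> {}"
      using that interior_of_subset [of X "\<Union>{N \<in> \<N> n. x \<in> N \<and> N \<subseteq> U}"] by auto
    then show ?thesis
      by (auto simp: expansion_def)
  qed
  with n show ?thesis
    by (meson openin_interior_of)
qed

lemma notin_closure_of_expansion:
  assumes "closedin X T" "x \<in> topspace X" "x \<notin> T"
  shows "\<exists>n. x \<notin> X closure_of expansion n T"
proof -
  have "openin X (topspace X - T)" "x \<in> topspace X - T"
    using assms by auto
  from expansion_meets [OF this] obtain n V where "openin X V" "x \<in> V"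
      and "\<And>S. expansion n S \<inter> V \<noteq> {} \<Longrightarrow> S \<inter> (topspace X - T) \<noteq> {}"
    by blast
  then have "expansion n T \<inter> V = {}"
    by blast
  then have "x \<notin> X closure_of expansion n T"
    using \<open>openin X V\<close> \<open>x \<in> V\<close> unfolding in_closure_of by blast
  then show ?thesis
    by blast
qed

text \<open>The open hulls of \<open>S\<close> and \<open>T\<close> are built from differences of
  expansions and closures of expansions. A common point with indices \<open>i \<le> j\<close> would
  lie in \<open>expansion j T\<close>, hence in \<open>expansion i T\<close>, whose closure was
  subtracted; the other case is symmetric.\<close>

lemma normal_space: "normal_space X"
  unfolding normal_space_def
proof (intro allI impI)
  fix S T assume ST: "closedin X S \<and> closedin X T \<and> disjnt S T"
  define U where "U S T = (\<Union>n. expansion n S - X closure_of expansion n T)" for S T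
  have op: "openin X (U S T)" for S T
    unfolding U_def by (intro openin_Union) (auto intro: openin_expansion openin_diff)
  have sub: "S \<subseteq> U S T" if "closedin X S" "closedin X T" "disjnt S T" for S T
  proof
    fix x assume x: "x \<in> S"
    then have "x \<in> topspace X" "x \<notin> T"
      using that closedin_subset by (auto simp: disjnt_iff)
    with notin_closure_of_expansion [OF that(2)] obtain n
      where "x \<notin> X closure_of expansion n T"
      by auto
    moreover have "x \<in> expansion n S"
      using subset_expansion closedin_subset that x by blast
    ultimately show "x \<in> U S T"
      by (auto simp: U_def)
  qed
  have "disjnt (U S T) (U T S)"
    unfolding disjnt_iff
  proof (intro allI notI, elim conjE)
    fix x assume "x \<in> U S T" "x \<in> U T S"
    then obtain i j where ij: "x \<in> expansion i S" "x \<notin> X closure_of expansion i T"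
        "x \<in> expansion j T" "x \<notin> X closure_of expansion j S"
      by (auto simp: U_def)
    have cl: "expansion n R \<subseteq> X closure_of expansion n R" for n R
      using openin_expansion by (intro closure_of_subset openin_subset)
    show False
    proof (cases "i \<le> j")
      case True
      then show ?thesis
        using ij expansion_antimono [of i j T] cl by blast
    next
      case False
      then show ?thesis
        using ij expansion_antimono [of j i S] cl by (meson nat_le_linear subsetD)
    qed
  qed
  then show "\<exists>U V. openin X U \<and> openin X V \<and> S \<subseteq> U \<and> T \<subseteq> V \<and> disjnt U V"
    using op sub [of S T] sub [of T S] ST
    by (intro exI [of _ "U S T"] exI [of _ "U T S"]) (auto simp: disjnt_sym)
qed

lemma sigma_locally_finite_base:
  obtains \<B> where "sigma_locally_finite_in X \<B>" "open_base_in X \<B>"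
proof -
  \<comment> \<open>\<open>Z m n\<close> is the open set on which the expansions at stage
    \<open>n\<close> of the members of \<open>\<N> m\<close> are locally finite.\<close>
  define Z where "Z m n = \<Union>{V. openin X V \<and> finite {N \<in> \<N> m. expansion n N \<inter> V \<noteq> {}}}" for m n
  \<comment> \<open>Closed sets that exhaust the open set \<open>Z m n\<close> as \<open>j\<close>
    varies. Normality fits an open \<open>P m n j\<close> between each of them and
    \<open>Z m n\<close>, with its closure still in \<open>Z m n\<close>.\<close>
  define E where "E m n j = \<Union>{N \<in> \<N> j. N \<subseteq> Z m n}" for m n j
  have openZ: "openin X (Z m n)" for m n
    unfolding Z_def by blast
  have "closedin X (E m n j)" for m n j
    unfolding E_def
    by (intro closedin_locally_finite_Union locally_finite_in_subset [OF locally_finite])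
      (auto intro: closed)
  moreover have "E m n j \<subseteq> Z m n" for m n j
    by (auto simp: E_def)
  ultimately have "\<exists>P. openin X P \<and> E m n j \<subseteq> P \<and> X closure_of P \<subseteq> Z m n" for m n j
    using normal_space openZ by (simp add: normal_space_alt)
  then obtain P where openP: "\<And>m n j. openin X (P m n j)" and EP: "\<And>m n j. E m n j \<subseteq> P m n j"
    and PZ: "\<And>m n j. X closure_of P m n j \<subseteq> Z m n"
    by metis
  \<comment> \<open>The interior of \<open>\<Union>\<F>\<close> makes the set small. The expansions
    make the family locally finite inside \<open>Z m n\<close>, and \<open>P m n j\<close> keeps it
    away from points outside \<open>Z m n\<close>.\<close>
  define B where "B m n j \<F> = (\<Inter>N\<in>\<F>. expansion n N \<inter> P m n j) \<inter> X interior_of \<Union>\<F>" for m n j \<F>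
  define I where "I m = {\<F>. \<F> \<subseteq> \<N> m \<and> finite \<F> \<and> \<F> \<noteq> {}}" for m
  have openB: "openin X (B m n j \<F>)" if "\<F> \<in> I m" for m n j \<F>
    unfolding B_def using that
    by (intro openin_Int openin_Inter openin_interior_of) (auto simp: I_def openP openin_expansion)
  have lf: "locally_finite_in X (B m n j ` I m)" for m n j
    unfolding locally_finite_in_def
  proof (intro conjI ballI)
    show "\<Union>(B m n j ` I m) \<subseteq> topspace X"
      using openB openin_subset by blast
  next
    fix x assume x: "x \<in> topspace X"
    have "\<exists>V. openin X V \<and> x \<in> V \<and> finite {\<F> \<in> I m. B m n j \<F> \<inter> V \<noteq> {}}"
    proof (cases "x \<in> Z m n")
      case True
      then obtain V where V: "openin X V" "x \<in> V" "finite {N \<in> \<N> m. expansion n N \<inter> V \<noteq> {}}"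
        by (auto simp: Z_def)
      \<comment> \<open>If \<open>B m n j \<F>\<close> meets \<open>V\<close>, so does the expansion
        of every member of \<open>\<F>\<close>; hence \<open>\<F>\<close> is a subset of a fixed
        finite set.\<close>
      have "{\<F> \<in> I m. B m n j \<F> \<inter> V \<noteq> {}} \<subseteq> Pow {N \<in> \<N> m. expansion n N \<inter> V \<noteq> {}}"
        by (auto simp: I_def B_def)
      then have "finite {\<F> \<in> I m. B m n j \<F> \<inter> V \<noteq> {}}"
        using V(3) by (meson finite_Pow_iff finite_subset)
      then show ?thesis
        using V by blast
    next
      case False
      have "P m n j \<subseteq> X closure_of P m n j"
        using openP by (intro closure_of_subset openin_subset)
      \<comment> \<open>Since \<open>\<F>\<close> is nonempty, \<open>B m n j \<F>\<close> lies in
        \<open>P m n j\<close>; the complement of the closure of \<open>P m n j\<close> is thus a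
        neighbourhood of \<open>x\<close> that meets no member.\<close>
      then have "B m n j \<F> \<inter> (topspace X - X closure_of P m n j) = {}" if "\<F> \<in> I m" for \<F>
        using that by (auto simp: I_def B_def)
      then have "{\<F> \<in> I m. B m n j \<F> \<inter> (topspace X - X closure_of P m n j) \<noteq> {}} = {}"
        by blast
      then have "finite {\<F> \<in> I m. B m n j \<F> \<inter> (topspace X - X closure_of P m n j) \<noteq> {}}"
        by (metis finite.emptyI)
      moreover have "openin X (topspace X - X closure_of P m n j)"
        by (intro openin_diff) simp_all
      moreover have "x \<in> topspace X - X closure_of P m n j"
        using False PZ x by auto
      ultimately show ?thesis
        by (intro exI conjI)
    qed
    then obtain V where V: "openin X V" "x \<in> V" "finite {\<F> \<in> I m. B m n j \<F> \<inter> V \<noteq> {}}"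
      by blast
    have "{W \<in> B m n j ` I m. W \<inter> V \<noteq> {}} \<subseteq> B m n j ` {\<F> \<in> I m. B m n j \<F> \<inter> V \<noteq> {}}"
      by blast
    then have "finite {W \<in> B m n j ` I m. W \<inter> V \<noteq> {}}"
      using V(3) finite_subset by blast
    then show "\<exists>V. openin X V \<and> x \<in> V \<and> finite {W \<in> B m n j ` I m. W \<inter> V \<noteq> {}}"
      using V by blast
  qed
  show thesis
  proof (rule that)
    show "sigma_locally_finite_in X (\<Union>(m, n, j)\<in>UNIV. B m n j ` I m)"
      by (rule sigma_locally_finite_in_UN)
        (auto intro: locally_finite_imp_sigma_locally_finite_in lf)
    show "open_base_in X (\<Union>(m, n, j)\<in>UNIV. B m n j ` I m)"
      unfolding open_base_in_def
    proof (intro conjI ballI allI impI)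
      fix C assume "C \<in> (\<Union>(m, n, j)\<in>UNIV. B m n j ` I m)"
      then show "openin X C"
        using openB by blast
    next
      fix U x assume U: "openin X U \<and> x \<in> U"
      then have x: "x \<in> topspace X"
        using openin_subset by blast
      obtain m where m: "x \<in> X interior_of \<Union>{N \<in> \<N> m. x \<in> N \<and> N \<subseteq> U}"
        using star U by blast
      define \<F> where "\<F> = {N \<in> \<N> m. x \<in> N \<and> N \<subseteq> U}"
      have "finite \<F>"
        by (rule finite_subset [OF _ locally_finite_in_point_finite [OF locally_finite, of m x]])
          (auto simp: \<F>_def)
      moreover have "\<F> \<noteq> {}"
        using m by (auto simp flip: \<F>_def)
      ultimately have "\<F> \<in> I m"
        by (auto simp: I_def \<F>_def)
      obtain W where W: "openin X W" "x \<in> W" "finite {N \<in> \<N> m. N \<inter> W \<noteq> {}}"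
        using locally_finite_inD [OF locally_finite x] .
      \<comment> \<open>Only finitely many members of \<open>\<N> m\<close> meet \<open>W\<close>,
        so only finitely many of their expansions meet \<open>V\<close>. This is how
        \<open>n\<close> is found with \<open>x\<close> in \<open>Z m n\<close>.\<close>
      obtain n V where V: "openin X V" "x \<in> V" "\<And>S. expansion n S \<inter> V \<noteq> {} \<Longrightarrow> S \<inter> W \<noteq> {}"
        using expansion_meets [OF W(1,2)] by blast
      have "finite {N \<in> \<N> m. expansion n N \<inter> V \<noteq> {}}"
        by (rule finite_subset [OF _ W(3)]) (use V(3) in blast)
      then have "x \<in> Z m n"
        using V by (auto simp: Z_def)
      then obtain j where "x \<in> X interior_of \<Union>{N \<in> \<N> j. x \<in> N \<and> N \<subseteq> Z m n}"
        using star [OF openZ] by blast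
      then have "x \<in> \<Union>{N \<in> \<N> j. x \<in> N \<and> N \<subseteq> Z m n}"
        using interior_of_subset by (rule subsetD [rotated])
      then have "x \<in> E m n j"
        by (auto simp: E_def)
      then have "x \<in> P m n j"
        using EP by blast
      moreover have "x \<in> expansion n N" if "N \<in> \<F>" for N
        using that x by (auto simp: \<F>_def expansion_def)
      ultimately have "x \<in> B m n j \<F>"
        using m by (auto simp: B_def \<F>_def)
      moreover have "B m n j \<F> \<subseteq> U"
        using interior_of_subset [of X "\<Union>\<F>"] by (auto simp: B_def \<F>_def)
      ultimately show "\<exists>C\<in>\<Union>(m, n, j)\<in>UNIV. B m n j ` I m. x \<in> C \<and> C \<subseteq> U"
        using \<open>\<F> \<in> I m\<close> by blast
    qed
  qed
qed

end

section \<open>Metrizability from closures of members of sigma-locally finite networks\<close>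

lemma (in closed_star_network) metrizable_space:
  assumes "regular_space X" "t1_space X"
  shows "metrizable_space X"
proof -
  obtain \<B> where "sigma_locally_finite_in X \<B>" "open_base_in X \<B>"
    by (rule sigma_locally_finite_base)
  then show ?thesis
    using normal_imp_metrizable_space normal_space assms by blast
qed

text \<open>Taking all stages up to \<open>n\<close> makes the families increasing and taking
  closures makes their members closed; both operations preserve local finiteness.\<close>

definition closures_upto :: "'a topology \<Rightarrow> (nat \<Rightarrow> 'a set set) \<Rightarrow> nat \<Rightarrow> 'a set set" where
  "closures_upto X \<A> n = (\<lambda>S. X closure_of S) ` (\<Union>i\<le>n. \<A> i)"

definition closure_star :: "'a topology \<Rightarrow> (nat \<Rightarrow> 'a set set) \<Rightarrow> 'a \<Rightarrow> 'a set \<Rightarrow> nat \<Rightarrow> 'a set" where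
  "closure_star X \<A> x U n = \<Union>{C \<in> closures_upto X \<A> n. x \<in> C \<and> C \<subseteq> U}"

lemma incseq_closure_star: "incseq (closure_star X \<A> x U)"
  by (fastforce simp: incseq_def closure_star_def closures_upto_def)

lemma closure_subset_closure_star:
  assumes "N \<in> \<A> i" "i \<le> n" "x \<in> X closure_of N" "X closure_of N \<subseteq> U"
  shows "X closure_of N \<subseteq> closure_star X \<A> x U n"
  using assms by (auto simp: closure_star_def closures_upto_def)

text \<open>The common last step of the converses for cp-, k- and ck-networks and of the
  Nagata-Smirnov theorem: only the neighbourhood property of the closure stars has to be
  checked.\<close>

lemma closure_star_network_imp_metrizable_space:
  assumes "regular_space X" "t1_space X" and lf: "\<And>n. locally_finite_in X (\<A> n)"
    and star: "\<And>U x. \<lbrakk>openin X U; x \<in> U\<rbrakk> \<Longrightarrow> \<exists>n. x \<in> X interior_of (closure_star X \<A> x U n)"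
  shows "metrizable_space X"
proof -
  interpret closed_star_network X "closures_upto X \<A>"
  proof
    show "locally_finite_in X (closures_upto X \<A> n)" for n
      unfolding closures_upto_def
      by (intro locally_finite_in_closure locally_finite_in_UN_atMost lf)
    show "closedin X N" if "N \<in> closures_upto X \<A> n" for n N
      using that by (auto simp: closures_upto_def)
    show "closures_upto X \<A> n \<subseteq> closures_upto X \<A> (Suc n)" for n
      by (auto simp: closures_upto_def atMost_Suc)
    show "\<exists>n. x \<in> X interior_of \<Union>{N \<in> closures_upto X \<A> n. x \<in> N \<and> N \<subseteq> U}"
      if "openin X U" "x \<in> U" for U x
      using star [OF that] by (simp add: closure_star_def)
  qed
  show ?thesis
    using assms by (intro metrizable_space)
qed

text \<open>A base set \<open>B\<close> between \<open>x\<close> and a smaller neighbourhood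
  \<open>V\<close> has its closure in \<open>U\<close>, so the closure star at the stage of
  \<open>B\<close> contains the open set \<open>B\<close>.\<close>

theorem Nagata_Smirnov:
  assumes "regular_space X" "t1_space X" "sigma_locally_finite_in X \<B>" "open_base_in X \<B>"
  shows "metrizable_space X"
proof -
  obtain b where lf: "\<And>n::nat. locally_finite_in X (b n)" and b: "\<B> = (\<Union>n. b n)"
    using assms(3) by (auto simp: sigma_locally_finite_in_def)
  show ?thesis
  proof (rule closure_star_network_imp_metrizable_space [OF assms(1,2) lf])
    fix U x assume "openin X U" "x \<in> U"
    then obtain V where V: "openin X V" "x \<in> V" "X closure_of V \<subseteq> U"
      using regular_space_closed_neighbourhood [OF \<open>regular_space X\<close>] by metis
    then obtain B where B: "B \<in> \<B>" "x \<in> B" "B \<subseteq> V"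
      using assms(4) unfolding open_base_in_def by metis
    then obtain n where n: "B \<in> b n"
      using b by blast
    have "openin X B"
      using B assms(4) by (auto simp: open_base_in_def)
    then have sub: "B \<subseteq> X closure_of B"
      by (intro closure_of_subset openin_subset)
    moreover have "X closure_of B \<subseteq> U"
      using closure_of_mono [OF B(3), of X] V(3) by blast
    ultimately have "X closure_of B \<subseteq> closure_star X b x U n"
      using n B by (intro closure_subset_closure_star) auto
    with sub have "B \<subseteq> X interior_of (closure_star X b x U n)"
      using \<open>openin X B\<close> by (intro interior_of_maximal) auto
    then show "\<exists>n. x \<in> X interior_of (closure_star X b x U n)"
      using B by blast
  qed
qed

lemma notin_interior_of_imp_in_closure_of:
  assumes "x \<in> topspace X" "x \<notin> X interior_of S"
  shows "x \<in> X closure_of (topspace X - S)"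
  using assms by (simp add: closure_of_complement)

subsection \<open>Networks and countable fan tightness\<close>

text \<open>If no closure star were a neighbourhood of \<open>x\<close>, fan tightness would select
  finite sets outside the stars that still accumulate at \<open>x\<close>. A network member with
  infinitely many of their points lies in all late stars, so it meets only finitely many of these
  finite sets.\<close>

lemma P_space_imp_metrizable_space:
  assumes "P_space X" "t1_space X" "countable_fan_tightness X"
  shows "metrizable_space X"
proof -
  have "regular_space X"
    using \<open>P_space X\<close> by (simp add: P_space_def)
  obtain \<N> where "sigma_locally_finite_in X \<N>" and \<N>: "cp_network_in X \<N>"
    using \<open>P_space X\<close> by (auto simp: P_space_def)
  then obtain \<A> where lf: "\<And>n::nat. locally_finite_in X (\<A> n)" and \<A>: "\<N> = (\<Union>n. \<A> n)"
    by (auto simp: sigma_locally_finite_in_def)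
  have sub: "N \<subseteq> X closure_of N" if "N \<in> \<N>" for N
    using that \<N> by (intro closure_of_subset) (auto simp: cp_network_in_def)
  show ?thesis
  proof (rule closure_star_network_imp_metrizable_space [OF \<open>regular_space X\<close> \<open>t1_space X\<close> lf])
    fix U x assume U: "openin X U" "x \<in> U"
    then have x: "x \<in> topspace X"
      using openin_subset by blast
    have cp: "cp_network_at X \<N> x"
      using \<N> x by (simp add: cp_network_in_def)
    let ?K = "closure_star X \<A> x U"
    show "\<exists>n. x \<in> X interior_of ?K n"
    proof (cases "isolated_point_in X x")
      case True
      then have "{x} \<in> \<N>"
        using cp by (simp add: cp_network_at_def)
      then obtain n where "{x} \<in> \<A> n"
        using \<A> by blast
      moreover have "X closure_of {x} = {x}"
        using \<open>t1_space X\<close> x by (simp add: closure_of_eq t1_space_closedin_singleton)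
      ultimately have "{x} \<subseteq> ?K n"
        using closure_subset_closure_star [of "{x}" \<A> n n x X U] U by simp
      then have "{x} \<subseteq> X interior_of ?K n"
        using True by (intro interior_of_maximal) (auto simp: isolated_point_in_def)
      then show ?thesis
        by blast
    next
      case False
      \<comment> \<open>Network members are taken inside \<open>V\<close>, which forces their
        closures into \<open>U\<close>.\<close>
      obtain V where V: "openin X V" "x \<in> V" "X closure_of V \<subseteq> U"
        using regular_space_closed_neighbourhood [OF \<open>regular_space X\<close> U] .
      then have "neighbourhood_in X x V"
        unfolding neighbourhood_in_def using openin_subset by blast
      then have net: "\<exists>N\<in>\<N>. x \<in> N \<and> N \<subseteq> V \<and> infinite (N \<inter> A)"
        if "A \<subseteq> topspace X" "x \<in> X closure_of A - A" for A
        using cp False that by (simp add: cp_network_at_def)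
      have in_K: "\<exists>m. \<forall>n\<ge>m. N \<subseteq> ?K n" if N: "N \<in> \<N>" "x \<in> N" "N \<subseteq> V" for N
      proof -
        obtain m where m: "N \<in> \<A> m"
          using N \<A> by blast
        have "X closure_of N \<subseteq> U"
          using closure_of_mono [OF \<open>N \<subseteq> V\<close>, of X] V(3) by blast
        then have "X closure_of N \<subseteq> ?K n" if "m \<le> n" for n
          using m that sub [OF N(1)] N(2) by (intro closure_subset_closure_star) auto
        then show ?thesis
          using sub [OF N(1)] by blast
      qed
      show ?thesis
      proof (rule ccontr)
        assume "\<nexists>n. x \<in> X interior_of ?K n"
        then have clo: "x \<in> X closure_of (topspace X - ?K n)" for n
          using x notin_interior_of_imp_in_closure_of by metis
        \<comment> \<open>As \<open>x\<close> is not isolated, the cp-property applies to the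
          complement of \<open>x\<close>; it yields a member containing \<open>x\<close>, whence
          \<open>x\<close> belongs to all late closure stars.\<close>
        have "x \<in> X closure_of (topspace X - {x}) - (topspace X - {x})"
        proof -
          have "x \<notin> X interior_of {x}"
          proof
            assume "x \<in> X interior_of {x}"
            then have "X interior_of {x} = {x}"
              using interior_of_subset [of X "{x}"] by auto
            then show False
              using False by (simp add: isolated_point_in_def interior_of_eq)
          qed
          then show ?thesis
            using notin_interior_of_imp_in_closure_of [OF x] by blast
        qed
        then obtain N where N: "N \<in> \<N>" "x \<in> N" "N \<subseteq> V"
          using net [of "topspace X - {x}"] by blast
        then obtain n0 where n0: "\<And>n. n \<ge> n0 \<Longrightarrow> x \<in> ?K n"
          using in_K [OF N] by blast
        \<comment> \<open>The shift by \<open>n0\<close> guarantees that \<open>x\<close> is in none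
          of the sets \<open>A n\<close>, as needed to apply the cp-property to a union of their
          subsets.\<close>
        define A where "A n = topspace X - ?K (n0 + n)" for n
        have "x \<in> (\<Inter>n. X closure_of A n)"
          using clo by (auto simp: A_def)
        moreover have "\<forall>n. A n \<subseteq> topspace X"
          by (auto simp: A_def)
        ultimately obtain F where F: "\<And>n. finite (F n)" "\<And>n. F n \<subseteq> A n"
            "x \<in> X closure_of (\<Union>n. F n)"
          using \<open>countable_fan_tightness X\<close> x unfolding countable_fan_tightness_def by metis
        have "x \<notin> (\<Union>n. F n)"
        proof
          assume "x \<in> (\<Union>n. F n)"
          then obtain n where "x \<notin> ?K (n0 + n)"
            using F(2) by (auto simp: A_def)
          then show False
            using n0 [of "n0 + n"] by simp
        qed
        moreover have "(\<Union>n. F n) \<subseteq> topspace X"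
          using F(2) by (auto simp: A_def)
        ultimately obtain N where N: "N \<in> \<N>" "x \<in> N" "N \<subseteq> V" "infinite (N \<inter> (\<Union>n. F n))"
          using net [of "\<Union>n. F n"] F(3) by blast
        obtain m where m: "\<And>n. n \<ge> m \<Longrightarrow> N \<subseteq> ?K n"
          using in_K [OF N(1-3)] by blast
        have "N \<inter> (\<Union>n. F n) \<subseteq> (\<Union>n<m. F n)"
        proof
          fix y assume "y \<in> N \<inter> (\<Union>n. F n)"
          then obtain n where "y \<in> N" "y \<in> F n"
            by blast
          then have "\<not> m \<le> n0 + n"
            using m F(2) by (force simp: A_def)
          then show "y \<in> (\<Union>n<m. F n)"
            using \<open>y \<in> F n\<close> by auto
        qed
        moreover have "finite (\<Union>n<m. F n)"
          using F(1) by blast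
        ultimately show False
          using N(4) finite_subset by blast
      qed
    qed
  qed
qed

subsection \<open>Networks and convergent sequences\<close>

text \<open>For each \<open>n\<close> some sequence outside \<open>K n\<close> converges to
  \<open>x\<close>, and \<open>(\<alpha>\<^sub>4)\<close> selects a convergent diagonal through
  distinct rows. Since \<open>K\<close> increases, a term from row \<open>m k\<close> avoids all
  \<open>K n\<close> with \<open>n \<le> m k\<close>.\<close>

lemma frechet_alpha4_escaping_sequence:
  fixes K :: "nat \<Rightarrow> 'a set"
  assumes "frechet_urysohn_space X" "alpha4_space X" "x \<in> topspace X"
    and "incseq K"
    and notin: "\<And>n. x \<notin> X interior_of K n"
  shows "\<exists>t. range t \<subseteq> topspace X \<and> limitin X t x sequentially \<and>
             (\<forall>n. eventually (\<lambda>k. t k \<notin> K n) sequentially)"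
proof -
  have "\<exists>s::nat \<Rightarrow> 'a. (\<forall>k. s k \<in> topspace X - K n) \<and> limitin X s x sequentially" for n
    using assms(1) notin_interior_of_imp_in_closure_of [OF assms(3) notin]
    unfolding frechet_urysohn_space_def by (metis Diff_subset)
  then obtain s where s: "\<And>n k::nat. s n k \<in> topspace X - K n"
    and lim: "\<And>n. limitin X (s n) x sequentially"
    by metis
  then have "\<exists>m n :: nat \<Rightarrow> nat. inj m \<and> limitin X (\<lambda>k. s (m k) (n k)) x sequentially"
    using assms(2,3) unfolding alpha4_space_def by (metis DiffD1)
  then obtain m j :: "nat \<Rightarrow> nat" where m: "inj m" "limitin X (\<lambda>k. s (m k) (j k)) x sequentially"
    by blast
  show ?thesis
  proof (intro exI conjI allI)
    show "range (\<lambda>k. s (m k) (j k)) \<subseteq> topspace X"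
      using s by blast
    show "eventually (\<lambda>k. s (m k) (j k) \<notin> K n) sequentially" for n
    proof -
      \<comment> \<open>Distinctness of the rows enters here: only finitely many \<open>k\<close>
        have \<open>m k < n\<close>.\<close>
      have "finite (m -` {..<n})"
        using m(1) by (intro finite_vimageI) auto
      then have "eventually (\<lambda>k. k \<notin> m -` {..<n}) sequentially"
        by (simp add: eventually_cofinite vimage_def flip: cofinite_eq_sequentially)
      then show ?thesis
      proof eventually_elim
        case (elim k)
        then have "K n \<subseteq> K (m k)"
          using \<open>incseq K\<close> by (simp add: incseq_def)
        then show ?case
          using s by blast
      qed
    qed
  qed fact
qed

text \<open>A sequence together with its limit remains compact when any of its terms are dropped.
  Intersecting with \<open>V\<close> fits the compact set into a prescribed neighbourhood of
  \<open>x\<close>, ready for a k- or ck-network.\<close>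

lemma compactin_convergent_subrange:
  assumes "range t \<subseteq> topspace X" "limitin X t x sequentially"
  shows "compactin X (insert x (range t \<inter> V))"
  using compactin_sequence_with_limit [of X t x] assms
  by blast

lemma finite_subset_stage:
  assumes "finite \<F>" "\<F> \<subseteq> (\<Union>n::nat. \<A> n)"
  obtains M where "\<And>N. N \<in> \<F> \<Longrightarrow> \<exists>i\<le>M. N \<in> \<A> i"
proof -
  have "\<forall>N\<in>\<F>. \<exists>i. N \<in> \<A> i"
    using assms by blast
  then obtain f where f: "\<And>N. N \<in> \<F> \<Longrightarrow> N \<in> \<A> (f N)"
    by metis
  have "\<exists>i\<le>Max (f ` \<F>). N \<in> \<A> i" if "N \<in> \<F>" for N
    using f [OF that] Max_ge [of "f ` \<F>" "f N"] assms(1) that by blast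
  then show thesis
    using that by blast
qed

text \<open>Finitely many network members cover the part in \<open>V\<close> of a sequence escaping
  all closure stars. The members of these that eventually matter have \<open>x\<close> in their
  closures, so the sequence is eventually in a single closure star.\<close>

lemma aleph_space_imp_metrizable_space:
  assumes "aleph_space X" "t1_space X" "frechet_urysohn_space X" "alpha4_space X"
  shows "metrizable_space X"
proof -
  have "regular_space X"
    using \<open>aleph_space X\<close> by (simp add: aleph_space_def)
  obtain \<N> where "sigma_locally_finite_in X \<N>" and \<N>: "k_network_in X \<N>"
    using \<open>aleph_space X\<close> by (auto simp: aleph_space_def)
  then obtain \<A> where lf: "\<And>n::nat. locally_finite_in X (\<A> n)" and \<A>: "\<N> = (\<Union>n. \<A> n)"
    by (auto simp: sigma_locally_finite_in_def)
  have sub: "N \<subseteq> X closure_of N" if "N \<in> \<N>" for N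
    using that \<N> by (intro closure_of_subset) (auto simp: k_network_in_def)
  show ?thesis
  proof (rule closure_star_network_imp_metrizable_space [OF \<open>regular_space X\<close> \<open>t1_space X\<close> lf])
    fix U x assume U: "openin X U" "x \<in> U"
    then have x: "x \<in> topspace X"
      using openin_subset by blast
    let ?K = "closure_star X \<A> x U"
    show "\<exists>n. x \<in> X interior_of ?K n"
    proof (rule ccontr)
      assume "\<nexists>n. x \<in> X interior_of ?K n"
      then have notin: "x \<notin> X interior_of ?K n" for n
        by simp
      obtain t where t: "range t \<subseteq> topspace X" "limitin X t x sequentially"
          "\<And>n. eventually (\<lambda>k. t k \<notin> ?K n) sequentially"
        using frechet_alpha4_escaping_sequence [OF assms(3,4) x incseq_closure_star notin] by blast
      obtain V where V: "openin X V" "x \<in> V" "X closure_of V \<subseteq> U"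
        using regular_space_closed_neighbourhood [OF \<open>regular_space X\<close> U] .
      have "compactin X (insert x (range t \<inter> V))"
        using t(1,2) by (rule compactin_convergent_subrange)
      moreover have "insert x (range t \<inter> V) \<subseteq> V"
        using V(2) by blast
      ultimately have "\<exists>\<F>. finite \<F> \<and> \<F> \<subseteq> \<N> \<and> insert x (range t \<inter> V) \<subseteq> \<Union>\<F> \<and> \<Union>\<F> \<subseteq> V"
        using \<N> V(1) unfolding k_network_in_def by meson
      then obtain \<F> where \<F>: "finite \<F>" "\<F> \<subseteq> \<N>" "range t \<inter> V \<subseteq> \<Union>\<F>" "\<Union>\<F> \<subseteq> V"
        by blast
      obtain M where M: "\<And>N. N \<in> \<F> \<Longrightarrow> \<exists>i\<le>M. N \<in> \<A> i"
        using finite_subset_stage \<F>(1,2) \<A> by metis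
      \<comment> \<open>A member from the k-network need not contain \<open>x\<close>, not even in
        its closure. The bad ones form a closed set that avoids \<open>x\<close>, and the sequence
        eventually leaves it.\<close>
      define C where "C = \<Union>((\<lambda>S. X closure_of S) ` {N \<in> \<F>. x \<notin> X closure_of N})"
      have "closedin X C"
        unfolding C_def using \<F>(1) by (intro closedin_Union) auto
      then have "openin X (V - C)" "x \<in> V - C"
        using V by (auto simp: C_def)
      then have "eventually (\<lambda>k. t k \<in> V - C) sequentially"
        using t(2) unfolding limitin_def by blast
      then have "eventually (\<lambda>k. t k \<in> ?K M) sequentially"
      proof eventually_elim
        case (elim k)
        then obtain N where N: "N \<in> \<F>" "t k \<in> N"
          using \<F>(3) by blast
        then have tN: "t k \<in> X closure_of N"
          using sub \<F>(2) by blast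
        then have "x \<in> X closure_of N"
          using N elim by (auto simp: C_def)
        moreover have "X closure_of N \<subseteq> U"
          using closure_of_mono [of N V X] N \<F>(4) V(3) by blast
        moreover obtain i where "i \<le> M" "N \<in> \<A> i"
          using M N by blast
        ultimately show ?case
          using closure_subset_closure_star tN by (metis subsetD)
      qed
      then have "eventually (\<lambda>k. False) sequentially"
        using t(3) [of M] by eventually_elim simp
      then show False
        by simp
    qed
  qed
qed

text \<open>The escaping sequence is caught as for a k-network, but every member of the finite
  family now contains \<open>x\<close>, so its closure takes part in the closure star
  directly.\<close>

lemma strict_aleph_space_imp_metrizable_space:
  assumes "strict_aleph_space X" "t1_space X" "frechet_urysohn_space X" "alpha4_space X"
  shows "metrizable_space X"
proof -
  have "regular_space X"
    using \<open>strict_aleph_space X\<close> by (simp add: strict_aleph_space_def)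
  obtain \<N> where "sigma_locally_finite_in X \<N>" and \<N>: "ck_network_in X \<N>"
    using \<open>strict_aleph_space X\<close> by (auto simp: strict_aleph_space_def)
  then obtain \<A> where lf: "\<And>n::nat. locally_finite_in X (\<A> n)" and \<A>: "\<N> = (\<Union>n. \<A> n)"
    by (auto simp: sigma_locally_finite_in_def)
  have sub: "N \<subseteq> X closure_of N" if "N \<in> \<N>" for N
    using that \<N> by (intro closure_of_subset) (auto simp: ck_network_in_def)
  show ?thesis
  proof (rule closure_star_network_imp_metrizable_space [OF \<open>regular_space X\<close> \<open>t1_space X\<close> lf])
    fix U x assume U: "openin X U" "x \<in> U"
    then have x: "x \<in> topspace X"
      using openin_subset by blast
    let ?K = "closure_star X \<A> x U"
    show "\<exists>n. x \<in> X interior_of ?K n"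
    proof (rule ccontr)
      assume "\<nexists>n. x \<in> X interior_of ?K n"
      then have notin: "x \<notin> X interior_of ?K n" for n
        by simp
      obtain t where t: "range t \<subseteq> topspace X" "limitin X t x sequentially"
          "\<And>n. eventually (\<lambda>k. t k \<notin> ?K n) sequentially"
        using frechet_alpha4_escaping_sequence [OF assms(3,4) x incseq_closure_star notin] by blast
      obtain V where V: "openin X V" "x \<in> V" "X closure_of V \<subseteq> U"
        using regular_space_closed_neighbourhood [OF \<open>regular_space X\<close> U] .
      then have "neighbourhood_in X x V"
        unfolding neighbourhood_in_def using openin_subset by blast
      then obtain W where "neighbourhood_in X x W"
        and W: "\<And>K. \<lbrakk>compactin X K; K \<subseteq> W\<rbrakk> \<Longrightarrow>
           \<exists>\<F>. finite \<F> \<and> \<F> \<subseteq> \<N> \<and> x \<in> \<Inter>\<F> \<and> K \<subseteq> \<Union>\<F> \<and> \<Union>\<F> \<subseteq> V"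
      proof -
        have "\<exists>W. neighbourhood_in X x W \<and> (\<forall>K. compactin X K \<and> K \<subseteq> W \<longrightarrow>
            (\<exists>\<F>. finite \<F> \<and> \<F> \<subseteq> \<N> \<and> x \<in> \<Inter>\<F> \<and> K \<subseteq> \<Union>\<F> \<and> \<Union>\<F> \<subseteq> V))"
          using \<N> x \<open>neighbourhood_in X x V\<close> by (simp add: ck_network_in_def ck_network_at_def)
        then show thesis
          using that by auto
      qed
      then obtain G where G: "openin X G" "x \<in> G" "G \<subseteq> W"
        by (auto simp: neighbourhood_in_def)
      have "compactin X (insert x (range t \<inter> G))"
        using t(1,2) by (rule compactin_convergent_subrange)
      moreover have "insert x (range t \<inter> G) \<subseteq> W"
        using G by blast
      ultimately have "\<exists>\<F>. finite \<F> \<and> \<F> \<subseteq> \<N> \<and> x \<in> \<Inter>\<F> \<and>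
          insert x (range t \<inter> G) \<subseteq> \<Union>\<F> \<and> \<Union>\<F> \<subseteq> V"
        by (rule W)
      then obtain \<F> where \<F>: "finite \<F>" "\<F> \<subseteq> \<N>" "x \<in> \<Inter>\<F>" "range t \<inter> G \<subseteq> \<Union>\<F>" "\<Union>\<F> \<subseteq> V"
        by blast
      obtain M where M: "\<And>N. N \<in> \<F> \<Longrightarrow> \<exists>i\<le>M. N \<in> \<A> i"
        using finite_subset_stage \<F>(1,2) \<A> by metis
      have "eventually (\<lambda>k. t k \<in> G) sequentially"
        using t(2) G by (simp add: limitin_def)
      then have "eventually (\<lambda>k. t k \<in> ?K M) sequentially"
      proof eventually_elim
        case (elim k)
        then obtain N where N: "N \<in> \<F>" "t k \<in> N"
          using \<F>(4) by blast
        then have tN: "t k \<in> X closure_of N" "x \<in> X closure_of N"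
          using sub \<F>(2,3) by blast+
        moreover have "X closure_of N \<subseteq> U"
          using closure_of_mono [of N V X] N \<F>(5) V(3) by blast
        moreover obtain i where "i \<le> M" "N \<in> \<A> i"
          using M N by blast
        ultimately show ?case
          using closure_subset_closure_star by (metis subsetD)
      qed
      then have "eventually (\<lambda>k. False) sequentially"
        using t(3) [of M] by eventually_elim simp
      then show False
        by simp
    qed
  qed
qed

subsection \<open>M-spaces\<close>

lemma seq_cluster_point_in_closure_of:
  assumes p: "seq_cluster_point X s p" and s: "\<And>k. k \<ge> n \<Longrightarrow> s k \<in> S"
  shows "p \<in> X closure_of S"
  unfolding in_closure_of
proof (intro conjI allI impI)
  show "p \<in> topspace X"
    using p by (simp add: seq_cluster_point_def)
  fix T assume "p \<in> T \<and> openin X T"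
  then have "infinite {k. s k \<in> T}"
    using p by (simp add: seq_cluster_point_def)
  then obtain k where "k \<ge> n" "s k \<in> T"
    by (auto simp: infinite_nat_iff_unbounded_le)
  then show "\<exists>y. y \<in> S \<and> y \<in> T"
    using s by blast
qed

text \<open>The base consists of finite intersections with one member from each of the covers
  \<open>0\<close> to \<open>n\<close>. They are formed one factor at a time, so that
  \<open>\<sigma>\<close>-local finiteness passes through the induction; \<open>shrink\<close> says
  that they get small at each point.\<close>

lemma sigma_locally_finite_base_from_covers:
  fixes \<V> :: "nat \<Rightarrow> 'a set set"
  assumes slf: "\<And>n. sigma_locally_finite_in X (\<V> n)"
    and cover: "\<And>n. open_cover_of X (\<V> n)"
    and shrink: "\<And>U x V. \<lbrakk>openin X U; x \<in> U; \<And>n. V n \<in> \<V> n; \<And>n. x \<in> V n\<rbrakk>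
                   \<Longrightarrow> \<exists>n::nat. (\<Inter>i\<le>n. V i) \<subseteq> U"
  obtains \<B> where "sigma_locally_finite_in X \<B>" "open_base_in X \<B>"
proof -
  define \<H> where "\<H> = rec_nat (\<V> 0) (\<lambda>n H. {A \<inter> B |A B. A \<in> H \<and> B \<in> \<V> (Suc n)})"
  have \<H>_0: "\<H> 0 = \<V> 0" and \<H>_Suc: "\<And>n. \<H> (Suc n) = {A \<inter> B |A B. A \<in> \<H> n \<and> B \<in> \<V> (Suc n)}"
    by (simp_all add: \<H>_def)
  have "sigma_locally_finite_in X (\<H> n)" for n
    by (induction n) (simp_all only: \<H>_0 \<H>_Suc slf sigma_locally_finite_in_Int)
  then have "sigma_locally_finite_in X (\<Union>n. \<H> n)"
    by (intro sigma_locally_finite_in_UN) auto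
  moreover have "openin X H" if "H \<in> \<H> n" for n H
    using that
  proof (induction n arbitrary: H)
    case 0
    then show ?case
      using cover by (auto simp: \<H>_0 open_cover_of_def)
  next
    case (Suc n)
    then show ?case
      using cover by (auto simp: \<H>_Suc open_cover_of_def)
  qed
  moreover have "\<exists>H\<in>\<Union>n. \<H> n. x \<in> H \<and> H \<subseteq> U" if U: "openin X U" "x \<in> U" for U x
  proof -
    have "x \<in> \<Union>(\<V> n)" for n
      using cover [of n] U openin_subset unfolding open_cover_of_def by blast
    then have "\<forall>n. \<exists>V. V \<in> \<V> n \<and> x \<in> V"
      by blast
    then obtain V where V: "\<And>n. V n \<in> \<V> n" "\<And>n. x \<in> V n"
      by metis
    have "(\<Inter>i\<le>n. V i) \<in> \<H> n" for n
    proof (induction n)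
      case (Suc n)
      have "(\<Inter>i\<le>Suc n. V i) = (\<Inter>i\<le>n. V i) \<inter> V (Suc n)"
        by (auto simp: atMost_Suc)
      moreover have "(\<Inter>i\<le>n. V i) \<inter> V (Suc n) \<in> \<H> (Suc n)"
        unfolding \<H>_Suc mem_Collect_eq
        by (rule exI [of _ "\<Inter>i\<le>n. V i"], rule exI [of _ "V (Suc n)"]) (simp add: Suc V)
      ultimately show ?case
        by simp
    qed (simp add: \<H>_0 V)
    moreover have "\<exists>n. (\<Inter>i\<le>n. V i) \<subseteq> U"
      by (rule shrink [OF U V])
    moreover from this obtain n where "(\<Inter>i\<le>n. V i) \<subseteq> U" ..
    ultimately show ?thesis
      using V(2) by (intro bexI [of _ "\<Inter>i\<le>n. V i"]) auto
  qed
  ultimately show thesis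
    by (intro that [of "\<Union>n. \<H> n"]) (auto simp: open_base_in_def)
qed

section \<open>Sequences of covers witnessing an M-space\<close>

locale M_sequence = normal_cover_sequence +
  assumes cluster: "\<And>x s. \<lbrakk>x \<in> topspace X; \<And>n. s n \<in> point_star (\<U> n) x\<rbrakk>
                      \<Longrightarrow> \<exists>p. seq_cluster_point X s p"
begin

text \<open>For a point \<open>x\<close> of the space, the class of \<open>x\<close> under the
  relation of lying in each other's stars at all levels; classically, a fibre of the quasi-perfect
  map of an M-space onto a metrizable space.\<close>

definition kernel :: "'a \<Rightarrow> 'a set" where
  "kernel x = (\<Inter>n. point_star (\<U> n) x)"

text \<open>The stars decrease, so a cluster point lies in the closure of each of them, and the
  closure of the star at level \<open>Suc n\<close> is contained in the star at level
  \<open>n\<close>.\<close>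

lemma cluster_in_kernel:
  assumes "x \<in> topspace X" and s: "\<And>n. s n \<in> point_star (\<U> n) x"
  obtains p where "seq_cluster_point X s p" "p \<in> kernel x"
proof -
  obtain p where p: "seq_cluster_point X s p"
    using cluster assms by blast
  have "p \<in> point_star (\<U> n) x" for n
  proof -
    have "s k \<in> point_star (\<U> (Suc n)) x" if "k \<ge> Suc n" for k
      using s [of k] point_star_antimono [OF that] by blast
    then have "p \<in> X closure_of point_star (\<U> (Suc n)) x"
      by (rule seq_cluster_point_in_closure_of [OF p])
    then show ?thesis
      using closure_of_point_star by blast
  qed
  then show thesis
    using that p by (auto simp: kernel_def)
qed

text \<open>Points of the kernel chosen from infinitely many distinct members would cluster
  somewhere, and every neighbourhood of the cluster point would meet infinitely many
  members.\<close>

lemma finite_meets_kernel: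
  assumes "x \<in> topspace X" "locally_finite_in X \<N>"
  shows "finite {N \<in> \<N>. N \<inter> kernel x \<noteq> {}}"
proof (rule ccontr)
  assume "infinite {N \<in> \<N>. N \<inter> kernel x \<noteq> {}}"
  then obtain N :: "nat \<Rightarrow> 'a set" where "inj N" and N: "range N \<subseteq> {N \<in> \<N>. N \<inter> kernel x \<noteq> {}}"
    using infinite_countable_subset by blast
  then have "\<forall>i. \<exists>z. z \<in> N i \<and> z \<in> kernel x"
    by blast
  then obtain z where z: "\<And>i. z i \<in> N i" "\<And>i. z i \<in> kernel x"
    by metis
  then have "z i \<in> point_star (\<U> i) x" for i
    by (simp add: kernel_def)
  then obtain p where p: "seq_cluster_point X z p"
    using cluster assms by blast
  then have "p \<in> topspace X"
    by (simp add: seq_cluster_point_def)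
  then obtain V where V: "openin X V" "p \<in> V" "finite {N \<in> \<N>. N \<inter> V \<noteq> {}}"
    using locally_finite_inD [OF assms(2)] by metis
  have "N ` {i. z i \<in> V} \<subseteq> {N \<in> \<N>. N \<inter> V \<noteq> {}}"
    using N z by blast
  then have "finite {i. z i \<in> V}"
    using V(3) \<open>inj N\<close> by (meson finite_imageD finite_subset inj_on_subset subset_UNIV)
  then show False
    using p V by (simp add: seq_cluster_point_def)
qed

text \<open>
  The kernel of a point is countably compact, so it meets only countably many members of the
  network; hence countably many members of the cover suffice for the kernel, and finitely many
  for a star.
\<close>

lemma point_star_finite_cover:
  assumes x: "x \<in> topspace X" and lf: "\<And>n::nat. locally_finite_in X (\<C> n)"
    and network: "\<And>U y. \<lbrakk>openin X U; y \<in> U\<rbrakk> \<Longrightarrow> \<exists>n. \<exists>N\<in>\<C> n. y \<in> N \<and> N \<subseteq> U"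
    and cover: "open_cover_of X \<P>"
  obtains m \<F> where "finite \<F>" "\<F> \<subseteq> \<P>" "point_star (\<U> m) x \<subseteq> \<Union>\<F>"
proof -
  \<comment> \<open>These members of the network cover the kernel and each lies in a member of
    \<open>\<P>\<close>; as only countably many members meet the kernel, countably many members of
    \<open>\<P>\<close> suffice.\<close>
  define \<K> where "\<K> = {N \<in> (\<Union>n. \<C> n). N \<inter> kernel x \<noteq> {} \<and> (\<exists>P\<in>\<P>. N \<subseteq> P)}"
  have "countable (\<Union>n. {N \<in> \<C> n. N \<inter> kernel x \<noteq> {}})"
    by (intro countable_UN [OF countableI_type] countable_finite finite_meets_kernel [OF x lf])
  then have "countable \<K>"
    by (rule countable_subset [rotated]) (auto simp: \<K>_def)
  have in_\<K>: "\<exists>N\<in>\<K>. q \<in> N" if "q \<in> topspace X" "q \<in> kernel x" for q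
  proof -
    obtain P where "P \<in> \<P>" "q \<in> P"
      using cover \<open>q \<in> topspace X\<close> unfolding open_cover_of_def by blast
    moreover from this have "openin X P"
      using cover by (simp add: open_cover_of_def)
    ultimately obtain n N where "N \<in> \<C> n" "q \<in> N" "N \<subseteq> P"
      using network by metis
    then show ?thesis
      using \<open>P \<in> \<P>\<close> that unfolding \<K>_def by blast
  qed
  have "x \<in> kernel x"
    using point_star_refl [OF x] by (simp add: kernel_def)
  then have "\<K> \<noteq> {}"
    using in_\<K> x by blast
  have "\<forall>N\<in>\<K>. \<exists>P. P \<in> \<P> \<and> N \<subseteq> P"
    by (auto simp: \<K>_def)
  then obtain P where P: "\<And>N. N \<in> \<K> \<Longrightarrow> P N \<in> \<P>" "\<And>N. N \<in> \<K> \<Longrightarrow> N \<subseteq> P N"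
    by metis
  define c where "c k = P (from_nat_into \<K> k)" for k
  have c: "c k \<in> \<P>" for k
    unfolding c_def using P(1) from_nat_into [OF \<open>\<K> \<noteq> {}\<close>] by blast
  \<comment> \<open>Otherwise pick a point of the \<open>n\<close>-th star outside the first
    \<open>Suc n\<close> sets \<open>c k\<close>. These points cluster in the kernel, hence in some
    open \<open>c k\<close>, yet none with index at least \<open>k\<close> lies there.\<close>
  have "\<exists>n. point_star (\<U> n) x \<subseteq> (\<Union>k\<le>n. c k)"
  proof (rule ccontr)
    assume "\<not> ?thesis"
    then have "\<forall>n. \<exists>y. y \<in> point_star (\<U> n) x \<and> y \<notin> (\<Union>k\<le>n. c k)"
      by blast
    then obtain s where s: "\<And>n. s n \<in> point_star (\<U> n) x" "\<And>n. s n \<notin> (\<Union>k\<le>n. c k)"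
      by metis
    obtain q where q: "seq_cluster_point X s q" "q \<in> kernel x"
      using cluster_in_kernel [OF x s(1)] by metis
    then obtain N where N: "N \<in> \<K>" "q \<in> N"
      using in_\<K> by (auto simp: seq_cluster_point_def)
    obtain k where "from_nat_into \<K> k = N"
      using \<open>countable \<K>\<close> N by (meson from_nat_into_to_nat_on)
    then have "q \<in> c k"
      using N P(2) by (auto simp: c_def)
    moreover have "openin X (c k)"
      using c cover by (simp add: open_cover_of_def)
    ultimately have "infinite {n. s n \<in> c k}"
      using q by (simp add: seq_cluster_point_def)
    then obtain n where "n \<ge> k" "s n \<in> c k"
      by (auto simp: infinite_nat_iff_unbounded_le)
    then show False
      using s(2) by blast
  qed
  then obtain n where "point_star (\<U> n) x \<subseteq> (\<Union>k\<le>n. c k)"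
    by blast
  then show thesis
    using c by (intro that [of "c ` {..n}" n]) auto
qed

text \<open>Stone's refinements \<open>\<W> m\<close> of the covers \<open>\<U> m\<close> need not
  refine \<open>\<P>\<close>. Those of their members that finitely many sets of \<open>\<P>\<close>
  cover are kept and cut by these sets; they still reach every point, because some star of it has a
  finite cover from \<open>\<P>\<close>.\<close>

lemma sigma_locally_finite_shrinking:
  assumes lf: "\<And>n::nat. locally_finite_in X (\<C> n)"
    and network: "\<And>U y. \<lbrakk>openin X U; y \<in> U\<rbrakk> \<Longrightarrow> \<exists>n. \<exists>N\<in>\<C> n. y \<in> N \<and> N \<subseteq> U"
    and cover: "open_cover_of X \<P>"
  obtains \<G> where "sigma_locally_finite_in X \<G>" "open_cover_of X \<G>"
    "\<And>G. G \<in> \<G> \<Longrightarrow> \<exists>P\<in>\<P>. G \<subseteq> P"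
proof -
  have "\<exists>\<W>. sigma_locally_finite_in X \<W> \<and> open_cover_of X \<W> \<and> (\<forall>W\<in>\<W>. \<exists>U\<in>\<U> m. W \<subseteq> U)" for m
    by (rule sigma_locally_finite_refinement [of m]) (auto simp: open_cover_of_def)
  then obtain \<W> where \<W>: "\<And>m. sigma_locally_finite_in X (\<W> m)" "\<And>m. open_cover_of X (\<W> m)"
      "\<And>m W. W \<in> \<W> m \<Longrightarrow> \<exists>U\<in>\<U> m. W \<subseteq> U"
    by metis
  define good where "good W \<F> \<longleftrightarrow> finite \<F> \<and> \<F> \<subseteq> \<P> \<and> W \<subseteq> \<Union>\<F>" for W \<F>
  define \<F> where "\<F> W = (SOME \<F>. good W \<F>)" for W
  define \<W>' where "\<W>' m = {W \<in> \<W> m. \<exists>\<F>. good W \<F>}" for m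
  have good: "good W (\<F> W)" if "W \<in> \<W>' m" for W m
    unfolding \<F>_def by (rule someI_ex) (use that in \<open>simp add: \<W>'_def\<close>)
  define \<G> where "\<G> = (\<Union>m. \<Union>W\<in>\<W>' m. (\<lambda>P. W \<inter> P) ` \<F> W)"
  have "sigma_locally_finite_in X (\<Union>W\<in>\<W>' m. (\<lambda>P. W \<inter> P) ` \<F> W)" for m
  proof (rule sigma_locally_finite_in_UN_finite)
    show "sigma_locally_finite_in X (\<W>' m)"
      by (rule sigma_locally_finite_in_subset [OF \<W>(1) [of m]]) (auto simp: \<W>'_def)
    show "finite ((\<lambda>P. W \<inter> P) ` \<F> W)" if "W \<in> \<W>' m" for W
      using good [OF that] by (simp add: good_def)
  qed auto
  then have "sigma_locally_finite_in X \<G>"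
    unfolding \<G>_def by (rule sigma_locally_finite_in_UN [OF countableI_type])
  moreover have openG: "openin X G \<and> (\<exists>P\<in>\<P>. G \<subseteq> P)" if "G \<in> \<G>" for G
  proof -
    note G_mem = that
    obtain m W P where G: "W \<in> \<W>' m" "P \<in> \<F> W" "G = W \<inter> P"
      using G_mem unfolding \<G>_def by blast
    then have "P \<in> \<P>"
      using good by (auto simp: good_def)
    moreover have "openin X W"
      using G \<W>(2) [of m] by (auto simp: \<W>'_def open_cover_of_def)
    ultimately show ?thesis
      using G cover by (auto simp: open_cover_of_def)
  qed
  moreover have "open_cover_of X \<G>"
    unfolding open_cover_of_def
  proof (intro conjI ballI)
    show "openin X G" if "G \<in> \<G>" for G
      using openG that by blast
    show "\<Union>\<G> = topspace X"
    proof
      show "\<Union>\<G> \<subseteq> topspace X"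
        using openG openin_subset by blast
      show "topspace X \<subseteq> \<Union>\<G>"
      proof
        fix x assume x: "x \<in> topspace X"
        obtain m \<F>' where \<F>': "finite \<F>'" "\<F>' \<subseteq> \<P>" "point_star (\<U> m) x \<subseteq> \<Union>\<F>'"
          using point_star_finite_cover [OF x lf network cover] .
        have "x \<in> \<Union>(\<W> m)"
          using x \<W>(2) [of m] by (simp add: open_cover_of_def)
        then obtain W where W: "W \<in> \<W> m" "x \<in> W"
          by blast
        then have "W \<subseteq> point_star (\<U> m) x"
          using \<W>(3) [OF W(1)] by (auto simp: point_star_def)
        then have "good W \<F>'"
          using \<F>' by (auto simp: good_def)
        then have "W \<in> \<W>' m"
          using W by (auto simp: \<W>'_def)
        then have "W \<subseteq> \<Union>(\<F> W)"
          using good by (simp add: good_def)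
        then obtain P where "P \<in> \<F> W" "x \<in> P"
          using W by blast
        then have "W \<inter> P \<in> \<G>" "x \<in> W \<inter> P"
          using \<open>W \<in> \<W>' m\<close> W by (auto simp: \<G>_def)
        then show "x \<in> \<Union>\<G>"
          by blast
      qed
    qed
  qed
  ultimately show thesis
    using that by blast
qed

lemma metrizable_space_if_network:
  assumes "Hausdorff_space X" "regular_space X"
    and lf: "\<And>n::nat. locally_finite_in X (\<C> n)"
    and closed: "\<And>n N. N \<in> \<C> n \<Longrightarrow> closedin X N"
    and mono: "\<And>m n. m \<le> n \<Longrightarrow> \<C> m \<subseteq> \<C> n"
    and network: "\<And>U y. \<lbrakk>openin X U; y \<in> U\<rbrakk> \<Longrightarrow> \<exists>n. \<exists>N\<in>\<C> n. y \<in> N \<and> N \<subseteq> U"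
  shows "metrizable_space X"
proof -
  \<comment> \<open>An open set whose points belong only to those members of \<open>\<C> n\<close>
    that contain \<open>y\<close>.\<close>
  define D where "D n y = topspace X - \<Union>{N \<in> \<C> n. y \<notin> N}" for n y
  have openD: "openin X (D n y)" for n y
    unfolding D_def
    by (intro openin_diff openin_topspace closedin_locally_finite_Union
        locally_finite_in_subset [OF lf]) (auto intro: closed)
  \<comment> \<open>Every member of \<open>\<C> n\<close> that meets the closure of such a
    \<open>P\<close> contains the same point \<open>y\<close>; two disjoint members therefore cannot
    both meet it.\<close>
  define \<P> where "\<P> n = {P. openin X P \<and> (\<exists>y. X closure_of P \<subseteq> D n y)}" for n
  have "open_cover_of X (\<P> n)" for n
    unfolding open_cover_of_def
  proof (intro conjI ballI)
    show "openin X P" if "P \<in> \<P> n" for P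
      using that by (simp add: \<P>_def)
    show "\<Union>(\<P> n) = topspace X"
    proof
      show "\<Union>(\<P> n) \<subseteq> topspace X"
        using openin_subset by (auto simp: \<P>_def)
      show "topspace X \<subseteq> \<Union>(\<P> n)"
      proof
        fix y assume "y \<in> topspace X"
        then have "y \<in> D n y"
          by (simp add: D_def)
        then obtain P where "openin X P" "y \<in> P" "X closure_of P \<subseteq> D n y"
          using regular_space_closed_neighbourhood [OF \<open>regular_space X\<close> openD] by metis
        then show "y \<in> \<Union>(\<P> n)"
          unfolding \<P>_def by blast
      qed
    qed
  qed
  note \<P> = this
  have "\<exists>\<G>. sigma_locally_finite_in X \<G> \<and> open_cover_of X \<G> \<and> (\<forall>G\<in>\<G>. \<exists>P\<in>\<P> n. G \<subseteq> P)" for n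
    by (rule sigma_locally_finite_shrinking [OF lf network \<P> [of n]]) auto
  then obtain \<G> where \<G>: "\<And>n. sigma_locally_finite_in X (\<G> n)" "\<And>n. open_cover_of X (\<G> n)"
      "\<And>n. \<forall>G\<in>\<G> n. \<exists>P\<in>\<P> n. G \<subseteq> P"
    by metis
  have "\<exists>\<W>. sigma_locally_finite_in X \<W> \<and> open_cover_of X \<W> \<and> (\<forall>W\<in>\<W>. \<exists>U\<in>\<U> m. W \<subseteq> U)" for m
    by (rule sigma_locally_finite_refinement [of m]) (auto simp: open_cover_of_def)
  then obtain \<W> where \<W>: "\<And>m. sigma_locally_finite_in X (\<W> m)" "\<And>m. open_cover_of X (\<W> m)"
      "\<And>m. \<forall>W\<in>\<W> m. \<exists>U\<in>\<U> m. W \<subseteq> U"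
    by metis
  \<comment> \<open>The factor from \<open>\<W> n\<close> keeps the sets inside the stars of their
    points, so that sequences cluster; the factor from \<open>\<G> n\<close> determines the cluster
    point.\<close>
  define \<V> where "\<V> n = {A \<inter> B |A B. A \<in> \<G> n \<and> B \<in> \<W> n}" for n
  obtain \<B> where "sigma_locally_finite_in X \<B>" "open_base_in X \<B>"
  proof (rule sigma_locally_finite_base_from_covers [of X \<V>])
    show "sigma_locally_finite_in X (\<V> n)" for n
      unfolding \<V>_def using \<G>(1) \<W>(1) by (rule sigma_locally_finite_in_Int)
    show "open_cover_of X (\<V> n)" for n
    proof -
      have "\<Union>(\<V> n) = \<Union>(\<G> n) \<inter> \<Union>(\<W> n)"
        unfolding \<V>_def by blast
      then show ?thesis
        using \<G>(2) [of n] \<W>(2) [of n] by (auto simp: open_cover_of_def \<V>_def)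
    qed
    show "\<exists>n. (\<Inter>i\<le>n. V i) \<subseteq> U"
      if U: "openin X U" "x \<in> U" and V: "\<And>n. V n \<in> \<V> n" "\<And>n. x \<in> V n" for U x V
    proof (rule ccontr)
      assume "\<not> ?thesis"
      then have "\<forall>n. \<exists>y. y \<in> (\<Inter>i\<le>n. V i) \<and> y \<notin> U"
        by blast
      then obtain s where s: "\<And>n. s n \<in> (\<Inter>i\<le>n. V i)" "\<And>n. s n \<notin> U"
        by metis
      have x: "x \<in> topspace X"
        using U openin_subset by blast
      have Vstar: "V n \<subseteq> point_star (\<U> n) x" for n
      proof -
        obtain W where "W \<in> \<W> n" "V n \<subseteq> W"
          using V(1) [of n] by (auto simp: \<V>_def)
        moreover from this obtain U' where "U' \<in> \<U> n" "W \<subseteq> U'"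
          using \<W>(3) [of n] by metis
        ultimately have "U' \<in> \<U> n" "V n \<subseteq> U'"
          by simp_all
        then show ?thesis
          using V(2) [of n] by (auto simp: point_star_def)
      qed
      have s_star: "s n \<in> point_star (\<U> n) x" for n
        using s(1) [of n] Vstar [of n] by auto
      from cluster [OF x this] obtain p where p: "seq_cluster_point X s p" ..
      then have "p \<in> topspace X"
        by (simp add: seq_cluster_point_def)
      have "s n \<in> topspace X" for n
        using s_star openin_subset [OF openin_point_star] by (rule subsetD [rotated])
      then have "p \<in> X closure_of (topspace X - U)"
        using s(2) by (intro seq_cluster_point_in_closure_of [OF p, of 0]) auto
      moreover have "closedin X (topspace X - U)"
        using U by blast
      ultimately have "p \<noteq> x"
        using U by (auto simp: closure_of_closedin)
      \<comment> \<open>Network members around \<open>x\<close> and \<open>p\<close> are placed in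
        disjoint open sets and brought to a common stage \<open>n\<close>. Both \<open>x\<close> and
        \<open>p\<close> lie in the closure of one \<open>P\<close> in \<open>\<P> n\<close>, so
        both members contain its point \<open>y\<close>, a contradiction.\<close>
      then obtain A B where AB: "openin X A" "openin X B" "x \<in> A" "p \<in> B" "disjnt A B"
        using \<open>Hausdorff_space X\<close> x \<open>p \<in> topspace X\<close> unfolding Hausdorff_space_def by metis
      obtain i N where N: "N \<in> \<C> i" "x \<in> N" "N \<subseteq> A"
        using network [OF AB(1,3)] by blast
      obtain j N' where N': "N' \<in> \<C> j" "p \<in> N'" "N' \<subseteq> B"
        using network [OF AB(2,4)] by blast
      define n where "n = max i j"
      have NC: "N \<in> \<C> n" "N' \<in> \<C> n"
        using mono [of i n] mono [of j n] N(1) N'(1) by (auto simp: n_def)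
      obtain G where "G \<in> \<G> n" "V n \<subseteq> G"
        using V(1) [of n] by (auto simp: \<V>_def)
      moreover from this obtain P where "P \<in> \<P> n" "G \<subseteq> P"
        using \<G>(3) [of n] by metis
      ultimately have "P \<in> \<P> n" "V n \<subseteq> P"
        by simp_all
      then obtain y where y: "X closure_of P \<subseteq> D n y" "openin X P"
        by (auto simp: \<P>_def)
      have "x \<in> X closure_of P"
        using V(2) [of n] \<open>V n \<subseteq> P\<close> closure_of_subset [OF openin_subset [OF y(2)]] by blast
      then have "y \<in> N"
        using y(1) N NC by (auto simp: D_def)
      have "s k \<in> P" if "n \<le> k" for k
        using s(1) [of k] that \<open>V n \<subseteq> P\<close> by blast
      then have "p \<in> X closure_of P"
        by (rule seq_cluster_point_in_closure_of [OF p])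
      then have "y \<in> N'"
        using y(1) N' NC by (auto simp: D_def)
      with \<open>y \<in> N\<close> show False
        using N N' AB(5) by (auto simp: disjnt_iff)
    qed
  qed
  then show ?thesis
    using Nagata_Smirnov assms(1,2) Hausdorff_imp_t1_space by blast
qed

end

text \<open>A cn-network has a member between a point and any neighbourhood of it; with regularity,
  the closures of the members form a closed network.\<close>

lemma strict_sigma_M_space_imp_metrizable_space:
  assumes "Hausdorff_space X" "strict_sigma_space X" "M_space X"
  shows "metrizable_space X"
proof -
  have "regular_space X"
    using assms(2) by (simp add: strict_sigma_space_def)
  obtain \<N> where "sigma_locally_finite_in X \<N>" and \<N>: "cn_network_in X \<N>"
    using assms(2) by (auto simp: strict_sigma_space_def)
  then obtain \<A> where lf: "\<And>n::nat. locally_finite_in X (\<A> n)" and \<A>: "\<N> = (\<Union>n. \<A> n)"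
    by (auto simp: sigma_locally_finite_in_def)
  obtain \<U> where "\<forall>n::nat. open_cover_of X (\<U> n)"
      "\<forall>x \<in> topspace X. \<forall>s. (\<forall>n. s n \<in> \<Union>{U \<in> \<U> n. x \<in> U}) \<longrightarrow> (\<exists>p. seq_cluster_point X s p)"
      "\<forall>n. star_refines (\<U> (Suc n)) (\<U> n)"
    using assms(3) unfolding M_space_def by (elim exE conjE)
  then interpret M_sequence X \<U>
    by unfold_locales (simp_all add: point_star_def)
  show ?thesis
  proof (rule metrizable_space_if_network [OF assms(1) \<open>regular_space X\<close>, of "closures_upto X \<A>"])
    show "locally_finite_in X (closures_upto X \<A> n)" for n
      unfolding closures_upto_def
      by (intro locally_finite_in_closure locally_finite_in_UN_atMost lf)
    show "closedin X N" if "N \<in> closures_upto X \<A> n" for n N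
      using that by (auto simp: closures_upto_def)
    show "closures_upto X \<A> m \<subseteq> closures_upto X \<A> n" if "m \<le> n" for m n
      using that by (fastforce simp: closures_upto_def)
    show "\<exists>n. \<exists>N\<in>closures_upto X \<A> n. y \<in> N \<and> N \<subseteq> U" if U: "openin X U" "y \<in> U" for U y
    proof -
      obtain V where V: "openin X V" "y \<in> V" "X closure_of V \<subseteq> U"
        using regular_space_closed_neighbourhood [OF \<open>regular_space X\<close> U] .
      then have y: "y \<in> topspace X" and "neighbourhood_in X y V"
        unfolding neighbourhood_in_def using openin_subset by blast+
      then have "neighbourhood_in X y (\<Union>{N \<in> \<N>. y \<in> N \<and> N \<subseteq> V})"
        using \<N> by (simp add: cn_network_in_def cn_network_at_def)
      then have "y \<in> \<Union>{N \<in> \<N>. y \<in> N \<and> N \<subseteq> V}"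
        unfolding neighbourhood_in_def by (elim conjE exE subsetD)
      then obtain N where N: "N \<in> \<N>" "y \<in> N" "N \<subseteq> V"
        by blast
      then obtain n where "N \<in> \<A> n"
        using \<A> by blast
      then have "X closure_of N \<in> closures_upto X \<A> n"
        by (auto simp: closures_upto_def)
      moreover have "N \<subseteq> X closure_of N"
        using N \<N> by (intro closure_of_subset) (auto simp: cn_network_in_def)
      moreover have "X closure_of N \<subseteq> U"
        using closure_of_mono [OF N(3), of X] V(3) by blast
      ultimately show ?thesis
        using N by blast
    qed
  qed
qed

subsection \<open>Metrizable spaces\<close>

lemma metrizable_space_shrinking_base:
  assumes "metrizable_space X" "x \<in> topspace X"
  obtains V :: "nat \<Rightarrow> 'a set" where "\<And>n. openin X (V n)" "\<And>n. x \<in> V n" "decseq V"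
    "\<forall>U. openin X U \<and> x \<in> U \<longrightarrow> (\<exists>n. V n \<subseteq> U)"
proof -
  obtain M d where "Metric_space M d" and X: "X = Metric_space.mtopology M d"
    using assms(1) by (auto simp: metrizable_space_def)
  interpret Metric_space M d
    by fact
  have x: "x \<in> M"
    using assms(2) by (simp add: X)
  show thesis
  proof (rule that [of "\<lambda>n. mball x (inverse (Suc n))"])
    show "decseq (\<lambda>n. mball x (inverse (Suc n)))"
      unfolding decseq_def by (intro allI impI mball_subset_concentric le_imp_inverse_le) auto
    show "\<forall>U. openin X U \<and> x \<in> U \<longrightarrow> (\<exists>n. mball x (inverse (Suc n)) \<subseteq> U)"
    proof (intro allI impI, elim conjE)
      fix U assume U: "openin X U" "x \<in> U"
      obtain r where "r > 0" "mball x r \<subseteq> U"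
        using U unfolding X openin_mtopology by blast
      moreover obtain n where "inverse (real (Suc n)) < r"
        using reals_Archimedean [OF \<open>r > 0\<close>] by blast
      ultimately show "\<exists>n. mball x (inverse (Suc n)) \<subseteq> U"
        using mball_subset_concentric [of "inverse (real (Suc n))" r x] by (meson less_imp_le order_trans)
    qed
  qed (auto simp: X x)
qed

lemma metrizable_imp_countable_fan_tightness:
  assumes "metrizable_space X"
  shows "countable_fan_tightness X"
  unfolding countable_fan_tightness_def
proof (intro ballI allI impI, elim conjE)
  fix x and A :: "nat \<Rightarrow> 'a set"
  assume x: "x \<in> topspace X" and A: "\<forall>n. A n \<subseteq> topspace X" and clo: "x \<in> (\<Inter>n. X closure_of A n)"
  obtain V where V: "\<And>n::nat. openin X (V n)" "\<And>n. x \<in> V n"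
      "\<forall>U. openin X U \<and> x \<in> U \<longrightarrow> (\<exists>n. V n \<subseteq> U)"
    using metrizable_space_shrinking_base [OF assms x] by metis
  have "\<exists>a. a \<in> A n \<and> a \<in> V n" for n
    using clo V(1,2) unfolding in_closure_of by (auto simp: in_closure_of)
  then obtain a where a: "\<And>n. a n \<in> A n" "\<And>n. a n \<in> V n"
    by metis
  have "x \<in> X closure_of (\<Union>n. {a n})"
    unfolding in_closure_of
  proof (intro conjI allI impI)
    fix T assume "x \<in> T \<and> openin X T"
    then obtain n where "V n \<subseteq> T"
      using V(3) by blast
    then show "\<exists>y. y \<in> (\<Union>n. {a n}) \<and> y \<in> T"
      using a(2) by blast
  qed fact
  then show "\<exists>F. (\<forall>n. finite (F n) \<and> F n \<subseteq> A n) \<and> x \<in> X closure_of (\<Union>n. F n)"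
    using a(1) by (intro exI [of _ "\<lambda>n. {a n}"]) auto
qed

lemma limitin_shrinking_base:
  fixes V :: "nat \<Rightarrow> 'a set"
  assumes "x \<in> topspace X" "decseq V" "\<forall>U. openin X U \<and> x \<in> U \<longrightarrow> (\<exists>n. V n \<subseteq> U)"
    and s: "\<And>n. s n \<in> V n"
  shows "limitin X s x sequentially"
  unfolding limitin_sequentially
proof (intro conjI allI impI)
  fix U assume "openin X U \<and> x \<in> U"
  then obtain n where "V n \<subseteq> U"
    using assms(3) by blast
  then have "s k \<in> U" if "n \<le> k" for k
    using s [of k] decseqD [OF \<open>decseq V\<close> that] by blast
  then show "\<exists>N. \<forall>n\<ge>N. s n \<in> U"
    by blast
qed fact

lemma metrizable_imp_frechet_urysohn_space:
  assumes "metrizable_space X"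
  shows "frechet_urysohn_space X"
  unfolding frechet_urysohn_space_def
proof (intro allI impI, elim conjE)
  fix A x assume "A \<subseteq> topspace X" and clo: "x \<in> X closure_of A"
  then have x: "x \<in> topspace X"
    by (simp add: in_closure_of)
  obtain V where V: "\<And>n::nat. openin X (V n)" "\<And>n. x \<in> V n" "decseq V"
      "\<forall>U. openin X U \<and> x \<in> U \<longrightarrow> (\<exists>n. V n \<subseteq> U)"
    using metrizable_space_shrinking_base [OF assms x] by metis
  have "\<exists>a. a \<in> A \<and> a \<in> V n" for n
    using clo V(1,2) by (auto simp: in_closure_of)
  then obtain s where s: "\<And>n. s n \<in> A" "\<And>n. s n \<in> V n"
    by metis
  then show "\<exists>s. (\<forall>n. s n \<in> A) \<and> limitin X s x sequentially"
    using limitin_shrinking_base [OF x V(3,4) s(2)] by blast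
qed

lemma metrizable_imp_alpha4_space:
  assumes "metrizable_space X"
  shows "alpha4_space X"
  unfolding alpha4_space_def
proof (intro ballI allI impI, elim conjE)
  fix x and s :: "nat \<Rightarrow> nat \<Rightarrow> 'a"
  assume x: "x \<in> topspace X" and lim: "\<forall>m. limitin X (s m) x sequentially"
  obtain V where V: "\<And>n::nat. openin X (V n)" "\<And>n. x \<in> V n" "decseq V"
      "\<forall>U. openin X U \<and> x \<in> U \<longrightarrow> (\<exists>n. V n \<subseteq> U)"
    using metrizable_space_shrinking_base [OF assms x] by metis
  have "\<exists>n. s k n \<in> V k" for k
    using lim V(1,2) unfolding limitin_sequentially by blast
  then obtain n where "\<And>k. s k (n k) \<in> V k"
    by metis
  then have "limitin X (\<lambda>k. s k (n k)) x sequentially"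
    by (rule limitin_shrinking_base [OF x V(3,4)])
  then show "\<exists>m n. inj m \<and> limitin X (\<lambda>k. s (m k) (n k)) x sequentially"
    by (intro exI [of _ id] exI [of _ n]) simp
qed

section \<open>Covers of a metric space by balls\<close>

context Metric_space
begin

text \<open>The ratio 1/3 is what star refinement requires: a ball meeting a second one of the same
  radius stays within three radii of the centre of the second.\<close>

definition ball_cover :: "nat \<Rightarrow> 'a set set" where
  "ball_cover n = (\<lambda>c. mball c ((1/3) ^ n)) ` M"

lemma normal_cover_sequence_ball_cover: "normal_cover_sequence mtopology ball_cover"
proof
  show "open_cover_of mtopology (ball_cover n)" for n
    by (auto simp: open_cover_of_def ball_cover_def)
  show "star_refines (ball_cover (Suc n)) (ball_cover n)" for n
    unfolding star_refines_def
  proof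
    fix V assume "V \<in> ball_cover (Suc n)"
    then obtain c where c: "c \<in> M" "V = mball c ((1/3) ^ Suc n)"
      by (auto simp: ball_cover_def)
    have "\<Union>{W \<in> ball_cover (Suc n). W \<inter> V \<noteq> {}} \<subseteq> mball c ((1/3) ^ n)"
    proof
      fix y assume "y \<in> \<Union>{W \<in> ball_cover (Suc n). W \<inter> V \<noteq> {}}"
      then obtain W z where "W \<in> ball_cover (Suc n)" "y \<in> W" "z \<in> W" "z \<in> V"
        by blast
      then obtain c' where c': "c' \<in> M" "y \<in> mball c' ((1/3) ^ Suc n)" "z \<in> mball c' ((1/3) ^ Suc n)"
        by (auto simp: ball_cover_def)
      have "d c y \<le> d c z + d z c' + d c' y"
        using triangle [of c z y] triangle [of z c' y] c c' \<open>z \<in> V\<close> by fastforce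
      also have "\<dots> < (1/3) ^ n"
        using c c' \<open>z \<in> V\<close> commute [of z c'] by simp
      finally show "y \<in> mball c ((1/3) ^ n)"
        using c c' by simp
    qed
    then show "\<exists>U\<in>ball_cover n. \<Union>{W \<in> ball_cover (Suc n). W \<inter> V \<noteq> {}} \<subseteq> U"
      using c by (auto simp: ball_cover_def)
  qed
qed

lemma point_star_ball_cover:
  assumes "openin mtopology U" "x \<in> U"
  shows "\<exists>n. \<forall>k\<ge>n. point_star (ball_cover k) x \<subseteq> U"
proof -
  obtain r where "r > 0" "mball x r \<subseteq> U"
    using assms unfolding openin_mtopology by blast
  \<comment> \<open>Points of the star share a ball with \<open>x\<close>, so they are less than two
    radii away from it.\<close>
  obtain n where n: "(1/3::real) ^ n < r / 2"
    using real_arch_pow_inv [of "r/2" "1/3"] \<open>r > 0\<close> by auto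
  have "point_star (ball_cover k) x \<subseteq> mball x r" if "n \<le> k" for k
  proof
    fix y assume "y \<in> point_star (ball_cover k) x"
    then obtain c where c: "c \<in> M" "x \<in> mball c ((1/3) ^ k)" "y \<in> mball c ((1/3) ^ k)"
      by (auto simp: point_star_def ball_cover_def)
    have "(1/3::real) ^ k \<le> (1/3) ^ n"
      using that by (intro power_decreasing) auto
    moreover have "d x y \<le> d x c + d c y"
      using c by (intro triangle) auto
    ultimately have "d x y < r"
      using c n commute [of x c] by (simp, linarith)
    then show "y \<in> mball x r"
      using c by simp
  qed
  then show ?thesis
    using \<open>mball x r \<subseteq> U\<close> by (meson order_trans)
qed

text \<open>The stars of \<open>x\<close> shrink to \<open>x\<close>, so a sequence chosen from them
  converges to \<open>x\<close>, which is the required cluster point.\<close>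

lemma M_space_mtopology: "M_space mtopology"
  unfolding M_space_def
proof (intro exI [of _ ball_cover] conjI allI ballI impI)
  interpret B: normal_cover_sequence mtopology ball_cover
    by (rule normal_cover_sequence_ball_cover)
  show "open_cover_of mtopology (ball_cover n)" "star_refines (ball_cover (Suc n)) (ball_cover n)" for n
    by (rule B.open_cover B.star_refines)+
  fix x and s :: "nat \<Rightarrow> 'a"
  assume x: "x \<in> topspace mtopology" and s: "\<forall>n. s n \<in> \<Union>{U \<in> ball_cover n. x \<in> U}"
  have "infinite {n. s n \<in> U}" if U: "openin mtopology U" "x \<in> U" for U
  proof -
    obtain n where "\<forall>k\<ge>n. point_star (ball_cover k) x \<subseteq> U"
      using point_star_ball_cover [OF U] ..
    then have "{n..} \<subseteq> {n. s n \<in> U}"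
      using s by (fastforce simp: point_star_def)
    then show ?thesis
      using infinite_Ici infinite_super by blast
  qed
  then show "\<exists>p. seq_cluster_point mtopology s p"
    using x by (auto simp: seq_cluster_point_def)
qed

text \<open>A member of the refinement of \<open>ball_cover n\<close> that contains \<open>x\<close>
  lies in the star of \<open>x\<close>; for large \<open>n\<close> this one factor already brings
  the intersection inside \<open>U\<close>.\<close>

lemma sigma_locally_finite_base_mtopology:
  obtains \<B> where "sigma_locally_finite_in mtopology \<B>" "open_base_in mtopology \<B>"
proof -
  interpret B: normal_cover_sequence mtopology ball_cover
    by (rule normal_cover_sequence_ball_cover)
  have "\<exists>\<W>. sigma_locally_finite_in mtopology \<W> \<and> open_cover_of mtopology \<W> \<and>
      (\<forall>W\<in>\<W>. \<exists>U\<in>ball_cover m. W \<subseteq> U)" for m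
    by (rule B.sigma_locally_finite_refinement [of m]) (auto simp: open_cover_of_def)
  then obtain \<W> where \<W>: "\<And>m. sigma_locally_finite_in mtopology (\<W> m)"
      "\<And>m. open_cover_of mtopology (\<W> m)" "\<And>m. \<forall>W\<in>\<W> m. \<exists>U\<in>ball_cover m. W \<subseteq> U"
    by metis
  show thesis
  proof (rule sigma_locally_finite_base_from_covers [OF \<W>(1,2)])
    show "\<exists>n. (\<Inter>i\<le>n. V i) \<subseteq> U"
      if U: "openin mtopology U" "x \<in> U" and V: "\<And>n. V n \<in> \<W> n" "\<And>n. x \<in> V n" for U x V
    proof -
      obtain n where "point_star (ball_cover n) x \<subseteq> U"
        using point_star_ball_cover [OF U] by auto
      moreover obtain U' where "U' \<in> ball_cover n" "V n \<subseteq> U'"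
        using \<W>(3) [of n] V(1) [of n] by metis
      then have "V n \<subseteq> point_star (ball_cover n) x"
        using V(2) [of n] by (auto simp: point_star_def)
      ultimately show ?thesis
        by (intro exI [of _ n]) blast
    qed
  qed (rule that)
qed

end

lemma metrizable_imp_sigma_locally_finite_base:
  assumes "metrizable_space X"
  obtains \<B> where "sigma_locally_finite_in X \<B>" "open_base_in X \<B>"
  using assms Metric_space.sigma_locally_finite_base_mtopology unfolding metrizable_space_def by metis

lemma metrizable_imp_M_space: "metrizable_space X \<Longrightarrow> M_space X"
  using Metric_space.M_space_mtopology unfolding metrizable_space_def by metis

section \<open>Open bases as networks of all four kinds\<close>

lemma open_base_in_subset_Pow: "open_base_in X \<B> \<Longrightarrow> \<B> \<subseteq> Pow (topspace X)"
  using openin_subset by (auto simp: open_base_in_def)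

lemma open_base_in_imp_cn_network_in:
  assumes "open_base_in X \<B>"
  shows "cn_network_in X \<B>"
  unfolding cn_network_in_def cn_network_at_def
proof (intro conjI ballI allI impI)
  show sub: "\<B> \<subseteq> Pow (topspace X)"
    using assms by (rule open_base_in_subset_Pow)
  fix x S assume "neighbourhood_in X x S"
  then obtain U where "openin X U" "x \<in> U" "U \<subseteq> S"
    by (auto simp: neighbourhood_in_def)
  then obtain B where B: "B \<in> \<B>" "x \<in> B" "B \<subseteq> S"
    using assms unfolding open_base_in_def by (meson order_trans)
  moreover from this have "openin X B"
    using assms by (simp add: open_base_in_def)
  ultimately show "neighbourhood_in X x (\<Union>{N \<in> \<B>. x \<in> N \<and> N \<subseteq> S})"
    unfolding neighbourhood_in_def using sub by (intro conjI exI [of _ B]) auto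
qed

text \<open>A base set \<open>B\<close> between \<open>x\<close> and the given neighbourhood serves
  both as the smaller neighbourhood and, through \<open>{B}\<close>, as the finite family for every
  compact set inside it.\<close>

lemma open_base_in_imp_ck_network_in:
  assumes "open_base_in X \<B>"
  shows "ck_network_in X \<B>"
  unfolding ck_network_in_def ck_network_at_def
proof (intro conjI ballI allI impI)
  show sub: "\<B> \<subseteq> Pow (topspace X)"
    using assms by (rule open_base_in_subset_Pow)
  fix x S assume "neighbourhood_in X x S"
  then obtain U where "openin X U" "x \<in> U" "U \<subseteq> S"
    by (auto simp: neighbourhood_in_def)
  then obtain B where B: "B \<in> \<B>" "x \<in> B" "B \<subseteq> S"
    using assms unfolding open_base_in_def by (meson order_trans)
  moreover from this have "openin X B"
    using assms by (simp add: open_base_in_def)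
  ultimately have "neighbourhood_in X x B"
    unfolding neighbourhood_in_def using sub by (intro conjI exI [of _ B]) auto
  moreover have "\<exists>\<F>. finite \<F> \<and> \<F> \<subseteq> \<B> \<and> x \<in> \<Inter>\<F> \<and> K \<subseteq> \<Union>\<F> \<and> \<Union>\<F> \<subseteq> S" if "K \<subseteq> B" for K
    using B that by (intro exI [of _ "{B}"]) auto
  ultimately show "\<exists>W. neighbourhood_in X x W \<and> (\<forall>K. compactin X K \<and> K \<subseteq> W \<longrightarrow>
      (\<exists>\<F>. finite \<F> \<and> \<F> \<subseteq> \<B> \<and> x \<in> \<Inter>\<F> \<and> K \<subseteq> \<Union>\<F> \<and> \<Union>\<F> \<subseteq> S))"
    by (intro exI [of _ B]) simp
qed

lemma open_base_in_imp_k_network_in: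
  assumes "open_base_in X \<B>"
  shows "k_network_in X \<B>"
  unfolding k_network_in_def
proof (intro conjI allI impI)
  show "\<B> \<subseteq> Pow (topspace X)"
    using assms by (rule open_base_in_subset_Pow)
next
  fix K U assume "compactin X K \<and> openin X U \<and> K \<subseteq> U"
  then have K: "compactin X K" and U: "openin X U" "K \<subseteq> U"
    by auto
  let ?\<U> = "{B \<in> \<B>. B \<subseteq> U}"
  have "K \<subseteq> \<Union>?\<U>"
  proof
    fix x assume "x \<in> K"
    then obtain B where "B \<in> \<B>" "x \<in> B" "B \<subseteq> U"
      using assms U unfolding open_base_in_def by (meson subsetD)
    then show "x \<in> \<Union>?\<U>"
      by blast
  qed
  moreover have "\<And>B. B \<in> ?\<U> \<Longrightarrow> openin X B"
    using assms by (simp add: open_base_in_def)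
  ultimately obtain \<F> where "finite \<F>" "\<F> \<subseteq> ?\<U>" "K \<subseteq> \<Union>\<F>"
    using compactinD [OF K, of ?\<U>] by metis
  then show "\<exists>\<F>. finite \<F> \<and> \<F> \<subseteq> \<B> \<and> K \<subseteq> \<Union>\<F> \<and> \<Union>\<F> \<subseteq> U"
    by (intro exI [of _ \<F>]) auto
qed

text \<open>A finite \<open>B \<inter> A\<close> would be closed and would not contain
  \<open>x\<close>; removing it from \<open>B\<close> would leave a neighbourhood of
  \<open>x\<close> that misses \<open>A\<close>.\<close>

lemma t1_space_infinite_Int:
  assumes "t1_space X" "openin X B" "x \<in> B" "x \<in> X closure_of A - A"
  shows "infinite (B \<inter> A)"
proof
  assume "finite (B \<inter> A)"
  then have "closedin X (B \<inter> A)"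
    using \<open>t1_space X\<close> openin_subset [OF \<open>openin X B\<close>] by (auto simp: t1_space_closedin_finite)
  then have "openin X (B - B \<inter> A)"
    using \<open>openin X B\<close> by blast
  moreover have "x \<in> B - B \<inter> A"
    using assms(3,4) by blast
  moreover have "\<forall>T. x \<in> T \<and> openin X T \<longrightarrow> (\<exists>y. y \<in> A \<and> y \<in> T)"
    using assms(4) by (simp add: in_closure_of)
  ultimately have "\<exists>y. y \<in> A \<and> y \<in> B - B \<inter> A"
    by metis
  then show False
    by blast
qed

lemma open_base_in_imp_cp_network_in:
  assumes "open_base_in X \<B>" "t1_space X"
  shows "cp_network_in X \<B>"
  unfolding cp_network_in_def
proof (intro conjI ballI)
  show "\<B> \<subseteq> Pow (topspace X)"
    using assms(1) by (rule open_base_in_subset_Pow)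
  fix x assume "x \<in> topspace X"
  show "cp_network_at X \<B> x"
  proof (cases "isolated_point_in X x")
    case True
    then have "\<exists>B\<in>\<B>. x \<in> B \<and> B \<subseteq> {x}"
      using assms(1) by (simp add: open_base_in_def isolated_point_in_def)
    then have "{x} \<in> \<B>"
      by (metis empty_iff subset_singletonD)
    then show ?thesis
      using True by (simp add: cp_network_at_def)
  next
    case False
    have "\<exists>N\<in>\<B>. x \<in> N \<and> N \<subseteq> S \<and> infinite (N \<inter> A)"
      if A: "x \<in> X closure_of A - A" and S: "neighbourhood_in X x S" for A S
    proof -
      obtain U where "openin X U" "x \<in> U" "U \<subseteq> S"
        using S by (auto simp: neighbourhood_in_def)
      then obtain B where B: "B \<in> \<B>" "x \<in> B" "B \<subseteq> S"
        using assms unfolding open_base_in_def by (meson order_trans)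
      then have "openin X B"
        using assms by (simp add: open_base_in_def)
      then show ?thesis
        using t1_space_infinite_Int [OF assms(2) _ B(2) A] B by blast
    qed
    then show ?thesis
      using False by (simp add: cp_network_at_def)
  qed
qed

theorem theorem4p5:
  fixes X :: "'a topology"
  assumes "Hausdorff_space X"
  shows "(metrizable_space X \<longleftrightarrow> P_space X \<and> countable_fan_tightness X) \<and>
         (metrizable_space X \<longleftrightarrow> aleph_space X \<and> frechet_urysohn_space X \<and> alpha4_space X) \<and>
         (metrizable_space X \<longleftrightarrow> strict_aleph_space X \<and> frechet_urysohn_space X \<and> alpha4_space X) \<and>
         (metrizable_space X \<longleftrightarrow> strict_sigma_space X \<and> M_space X)"
proof -
  have t1: "t1_space X"
    using assms by (rule Hausdorff_imp_t1_space)
  \<comment> \<open>A single \<open>\<sigma>\<close>-locally finite base serves as the network in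
    all four definitions.\<close>
  have "P_space X \<and> aleph_space X \<and> strict_aleph_space X \<and> strict_sigma_space X"
    if metr: "metrizable_space X"
  proof -
    obtain \<B> where "sigma_locally_finite_in X \<B>" and base: "open_base_in X \<B>"
      using metrizable_imp_sigma_locally_finite_base [OF metr] .
    moreover have "regular_space X"
      using metr by (rule metrizable_imp_regular_space)
    moreover note open_base_in_imp_cp_network_in [OF base t1] open_base_in_imp_k_network_in [OF base]
      open_base_in_imp_ck_network_in [OF base] open_base_in_imp_cn_network_in [OF base]
    ultimately show ?thesis
      unfolding P_space_def aleph_space_def strict_aleph_space_def strict_sigma_space_def by blast
  qed
  then show ?thesis
    using metrizable_imp_countable_fan_tightness [of X] metrizable_imp_frechet_urysohn_space [of X]
      metrizable_imp_alpha4_space [of X] metrizable_imp_M_space [of X]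
      P_space_imp_metrizable_space [OF _ t1] aleph_space_imp_metrizable_space [OF _ t1]
      strict_aleph_space_imp_metrizable_space [OF _ t1]
      strict_sigma_M_space_imp_metrizable_space [OF assms]
    by blast
qed

end
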